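(* Let $M$ be a smooth $m$-dimensional manifold and let $F:M\to(\mathbb{R}^n,\langle\cdot,\cdot\rangle)$ be an immersion such that $g:=F^*\langle\cdot,\cdot\rangle$ is nondegenerate and $\|F\|^2=k$ is constant with $k<0$. Then the solution of the mean curvature flow with initial immersion $F$ is a homothety if and only if $F:M\to\mathcal{H}^{n-1}(k)$ is a minimal immersion in the hyperquadric $\mathcal{H}^{n-1}(k)$. In this case the mean curvature flow of $F$ has a solution $F:M\times[0,\infty)\to(\mathbb{R}^n,\langle\cdot,\cdot\rangle)$, and the solution is $F(x,t)=c^{-1}(t)F(x)$ with $c(t)=\sqrt{-k}\,(-k+2mt)^{-1/2}$ for all $(x,t)\in M\times[0,\infty)$.
   Context: $\langle\cdot,\cdot\rangle$ is a nondegenerate symmetric bilinear form on $\mathbb{R}^n$ (not necessarily definite); $\|X\|^2=\langle X,X\rangle$; $\mathcal{H}^{n-1}(k)=\{x\in\mathbb{R}^n:\|x\|^2=k\}$. "Minimal" means that the mean curvature vector of $F$ as an immersion into the semi-Riemannian hypersurface $\mathcal{H}^{n-1}(k)$ vanishes. $M$ is connected, orientable and complete, of positive dimension. A solution of the mean curvature flow with initial immersion $F_0:M\to(\mathbb{R}^n,\langle\cdot,\cdot\rangle)$ is a smooth family of immersions $F:M\times[0,T)\to\mathbb{R}^n$, $T>0$ (possibly $\infty$), with $F(\cdot,t)^*\langle\cdot,\cdot\rangle$ nondegenerate for all $t$, $\frac{dF}{dt}(p,t)=\vec H(p,t)$ and $F(p,0)=F_0(p)$, where $\vec H(\cdot,t)$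 is the mean curvature vector (trace of the second fundamental tensor) of $F(\cdot,t)$. Such a solution is a homothety if there is a differentiable $c:[0,T)\to(0,\infty)$ with $c(0)=1$ and $\vec H=-\frac{\dot c}{c}F^\perp$, where $F^\perp$ is the normal part of the position vector. "The solution of the mean curvature flow is a homothety" is understood as: the mean curvature flow with this initial immersion has a solution which is a homothety (it is then unique among homothetic solutions on a given time interval). *)

theory Defs
  imports "HOL-Analysis.Analysis"
begin

section \<open>Smooth functions\<close>

text \<open>
  Derivatives are taken within \<open>S\<close>, so that on a set \<open>U \<times> [0, T)\<close> with \<open>U\<close> open
  the time derivatives at time 0 are one-sided. On open sets and on such products the
  derivative is unique, so \<open>f'\<close> below is the derivative of \<open>f\<close>.
\<close>

primrec Ck_on :: "nat \<Rightarrow> 'a::euclidean_space set \<Rightarrow> ('a \<Rightarrow> 'b::real_normed_vector) \<Rightarrow> bool" where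
  "Ck_on 0 S f = continuous_on S f"
| "Ck_on (Suc r) S f =
     (\<exists>f'. (\<forall>x\<in>S. (f has_derivative f' x) (at x within S)) \<and> (\<forall>e\<in>Basis. Ck_on r S (\<lambda>x. f' x e)))"

definition smooth_on :: "'a::euclidean_space set \<Rightarrow> ('a \<Rightarrow> 'b::real_normed_vector) \<Rightarrow> bool" where
  "smooth_on S f \<longleftrightarrow> (\<forall>r. Ck_on r S f)"

definition partial :: "'m::finite \<Rightarrow> (real^'m \<Rightarrow> 'b::real_normed_vector) \<Rightarrow> real^'m \<Rightarrow> 'b" where
  "partial i f x = frechet_derivative f (at x) (axis i 1)"

section \<open>Smooth manifolds\<close>

text \<open>
  A chart is a pair \<open>(U, \<phi>)\<close>. A manifold is given by an atlas; its underlying set is the union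
  of the chart domains, an open subset of a second countable Hausdorff space. The dimension
  is \<open>CARD('m)\<close>, hence positive.
\<close>

type_synonym ('a, 'm) chart = "'a set \<times> ('a \<Rightarrow> real^'m)"

definition is_chart :: "('a::{t2_space, second_countable_topology}, 'm::finite) chart \<Rightarrow> bool" where
  "is_chart = (\<lambda>(U, \<phi>). open U \<and> open (\<phi> ` U) \<and> homeomorphism U (\<phi> ` U) \<phi> (inv_into U \<phi>))"

definition transition :: "('a, 'm::finite) chart \<Rightarrow> ('a, 'm) chart \<Rightarrow> real^'m \<Rightarrow> real^'m" where
  "transition = (\<lambda>(U, \<phi>) (V, \<psi>). \<psi> \<circ> inv_into U \<phi>)"

definition overlap :: "('a, 'm::finite) chart \<Rightarrow> ('a, 'm) chart \<Rightarrow> (real^'m) set" where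
  "overlap = (\<lambda>(U, \<phi>) (V, \<psi>). \<phi> ` (U \<inter> V))"

definition smooth_atlas ::
  "('a::{t2_space, second_countable_topology}, 'm::finite) chart set \<Rightarrow> bool" where
  "smooth_atlas A \<longleftrightarrow>
     (\<forall>c\<in>A. is_chart c) \<and> (\<forall>c\<in>A. \<forall>d\<in>A. smooth_on (overlap c d) (transition c d))"

definition carrier :: "('a, 'm::finite) chart set \<Rightarrow> 'a set" where
  "carrier A = \<Union> (fst ` A)"

definition orientable ::
  "('a::{t2_space, second_countable_topology}, 'm::finite) chart set \<Rightarrow> bool" where
  "orientable A \<longleftrightarrow>
     (\<exists>A'. smooth_atlas (A \<union> A') \<and> carrier A' = carrier A \<and>
        (\<forall>c\<in>A'. \<forall>d\<in>A'. \<forall>x\<in>overlap c d.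
           det (matrix (frechet_derivative (transition c d) (at x))) > 0))"

text \<open>Used only for notions that do not depend on the choice of the chart around the point.\<close>

definition chart_at :: "('a, 'm::finite) chart set \<Rightarrow> 'a \<Rightarrow> ('a, 'm) chart" where
  "chart_at A p = (SOME c. c \<in> A \<and> p \<in> fst c)"

definition local_rep :: "('a, 'm::finite) chart \<Rightarrow> ('a \<Rightarrow> 'b) \<Rightarrow> real^'m \<Rightarrow> 'b" where
  "local_rep = (\<lambda>(U, \<phi>) f. f \<circ> inv_into U \<phi>)"

definition immersion :: "('a, 'm::finite) chart set \<Rightarrow> ('a \<Rightarrow> real^'n) \<Rightarrow> bool" where
  "immersion A F \<longleftrightarrow>
     (\<forall>(U, \<phi>)\<in>A. smooth_on (\<phi> ` U) (local_rep (U, \<phi>) F) \<and>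
        (\<forall>x\<in>\<phi> ` U. inj (frechet_derivative (local_rep (U, \<phi>) F) (at x))))"

section \<open>Bilinear forms\<close>

definition nondegenerate :: "('v::zero \<Rightarrow> 'v \<Rightarrow> real) \<Rightarrow> bool" where
  "nondegenerate b \<longleftrightarrow> (\<forall>v. (\<forall>w. b v w = 0) \<longrightarrow> v = 0)"

text \<open>The projection is well defined when \<open>b\<close> restricted to the subspace \<open>W\<close> is nondegenerate.\<close>

definition orth_proj :: "('v::real_vector \<Rightarrow> 'v \<Rightarrow> real) \<Rightarrow> 'v set \<Rightarrow> 'v \<Rightarrow> 'v" where
  "orth_proj b W v = (THE w. w \<in> W \<and> (\<forall>u\<in>W. b (v - w) u = 0))"

definition hyperquadric :: "(real^'n \<Rightarrow> real^'n \<Rightarrow> real) \<Rightarrow> real \<Rightarrow> (real^'n) set" where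
  "hyperquadric b k = {x. b x x = k}"

section \<open>The induced metric and its Levi-Civita connection\<close>

text \<open>In this section \<open>f\<close> is the representation in a chart of a map into \<open>real^'n\<close>.\<close>

definition pullback ::
  "(real^'n \<Rightarrow> real^'n \<Rightarrow> real) \<Rightarrow> (real^'m::finite \<Rightarrow> real^'n) \<Rightarrow> real^'m \<Rightarrow> real^'m \<Rightarrow> real^'m \<Rightarrow> real"
  where
  "pullback b f x v w = b (frechet_derivative f (at x) v) (frechet_derivative f (at x) w)"

definition gram ::
  "(real^'n \<Rightarrow> real^'n \<Rightarrow> real) \<Rightarrow> (real^'m::finite \<Rightarrow> real^'n) \<Rightarrow> real^'m \<Rightarrow> real^'m^'m" where
  "gram b f x = (\<chi> i j. pullback b f x (axis i 1) (axis j 1))"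

definition gram_inv ::
  "(real^'n \<Rightarrow> real^'n \<Rightarrow> real) \<Rightarrow> (real^'m::finite \<Rightarrow> real^'n) \<Rightarrow> real^'m \<Rightarrow> real^'m^'m" where
  "gram_inv b f x = matrix_inv (gram b f x)"

definition christoffel ::
  "(real^'n \<Rightarrow> real^'n \<Rightarrow> real) \<Rightarrow> (real^'m::finite \<Rightarrow> real^'n) \<Rightarrow> real^'m \<Rightarrow> 'm \<Rightarrow> 'm \<Rightarrow> 'm \<Rightarrow> real"
  where
  "christoffel b f x l i j =
     1/2 * (\<Sum>r\<in>UNIV. gram_inv b f x $ l $ r *
       (partial i (\<lambda>y. gram b f y $ j $ r) x + partial j (\<lambda>y. gram b f y $ i $ r) x
        - partial r (\<lambda>y. gram b f y $ i $ j) x))"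

definition nondegenerate_metric ::
  "(real^'n \<Rightarrow> real^'n \<Rightarrow> real) \<Rightarrow> ('a, 'm::finite) chart set \<Rightarrow> ('a \<Rightarrow> real^'n) \<Rightarrow> bool" where
  "nondegenerate_metric b A F \<longleftrightarrow>
     (\<forall>(U, \<phi>)\<in>A. \<forall>x\<in>\<phi> ` U. nondegenerate (pullback b (local_rep (U, \<phi>) F) x))"

text \<open>Geodesics of the induced metric, defined on the whole real line.\<close>

definition geodesic_line ::
  "(real^'n \<Rightarrow> real^'n \<Rightarrow> real) \<Rightarrow> ('a::{t2_space, second_countable_topology}, 'm::finite) chart set \<Rightarrow>
    ('a \<Rightarrow> real^'n) \<Rightarrow> (real \<Rightarrow> 'a) \<Rightarrow> bool" where
  "geodesic_line b A F \<gamma> \<longleftrightarrow>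
     range \<gamma> \<subseteq> carrier A \<and> continuous_on UNIV \<gamma> \<and>
     (\<forall>(U, \<phi>)\<in>A. \<exists>v. \<forall>t. \<gamma> t \<in> U \<longrightarrow>
        ((\<phi> \<circ> \<gamma>) has_vector_derivative v t) (at t) \<and>
        (v has_vector_derivative
           (\<chi> l. - (\<Sum>i\<in>UNIV. \<Sum>j\<in>UNIV.
              christoffel b (local_rep (U, \<phi>) F) (\<phi> (\<gamma> t)) l i j * v t $ i * v t $ j))) (at t))"

definition complete_metric ::
  "(real^'n \<Rightarrow> real^'n \<Rightarrow> real) \<Rightarrow> ('a::{t2_space, second_countable_topology}, 'm::finite) chart set \<Rightarrow>
    ('a \<Rightarrow> real^'n) \<Rightarrow> bool" where
  "complete_metric b A F \<longleftrightarrow>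
     (\<forall>(U, \<phi>)\<in>A. \<forall>p\<in>U. \<forall>v. \<exists>\<gamma>. geodesic_line b A F \<gamma> \<and> \<gamma> 0 = p \<and>
        ((\<phi> \<circ> \<gamma>) has_vector_derivative v) (at 0))"

section \<open>Second fundamental tensors and mean curvature\<close>

text \<open>
  The second fundamental tensor of an immersion is
  \<open>II(X, Y) = D\<^bsub>X\<^esub> (dF(Y)) - dF(\<nabla>\<^bsub>X\<^esub> Y)\<close> for the Levi-Civita connections \<open>D\<close> of the target
  and \<open>\<nabla>\<close> of the induced metric. The Levi-Civita connection of a semi-Riemannian hypersurface
  of \<open>real^'n\<close> is the tangential part of the flat connection; the argument \<open>P\<close> is this
  projection at each point of the target, and the identity if the target is \<open>real^'n\<close> itself.
\<close>

definition second_fundamental ::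
  "(real^'n \<Rightarrow> real^'n \<Rightarrow> real^'n) \<Rightarrow> (real^'n \<Rightarrow> real^'n \<Rightarrow> real) \<Rightarrow> (real^'m::finite \<Rightarrow> real^'n) \<Rightarrow>
    real^'m \<Rightarrow> 'm \<Rightarrow> 'm \<Rightarrow> real^'n" where
  "second_fundamental P b f x i j =
     P (f x) (partial i (partial j f) x) - (\<Sum>l\<in>UNIV. christoffel b f x l i j *\<^sub>R partial l f x)"

definition trace_second_fundamental ::
  "(real^'n \<Rightarrow> real^'n \<Rightarrow> real^'n) \<Rightarrow> (real^'n \<Rightarrow> real^'n \<Rightarrow> real) \<Rightarrow> ('a, 'm::finite) chart set \<Rightarrow>
    ('a \<Rightarrow> real^'n) \<Rightarrow> 'a \<Rightarrow> real^'n" where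
  "trace_second_fundamental P b A F p =
     (let c = chart_at A p; f = local_rep c F; x = snd c p
      in \<Sum>i\<in>UNIV. \<Sum>j\<in>UNIV. gram_inv b f x $ i $ j *\<^sub>R second_fundamental P b f x i j)"

definition mean_curvature ::
  "(real^'n \<Rightarrow> real^'n \<Rightarrow> real) \<Rightarrow> ('a, 'm::finite) chart set \<Rightarrow> ('a \<Rightarrow> real^'n) \<Rightarrow> 'a \<Rightarrow> real^'n" where
  "mean_curvature b A F p = trace_second_fundamental (\<lambda>y v. v) b A F p"

text \<open>The tangent space of the hyperquadric at \<open>y\<close> is the kernel of the derivative of \<open>b y y\<close>.\<close>

definition hyperquadric_mean_curvature ::
  "(real^'n \<Rightarrow> real^'n \<Rightarrow> real) \<Rightarrow> ('a, 'm::finite) chart set \<Rightarrow> ('a \<Rightarrow> real^'n) \<Rightarrow> 'a \<Rightarrow> real^'n" where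
  "hyperquadric_mean_curvature b A F p =
     trace_second_fundamental (\<lambda>y. orth_proj b {v. b y v = 0}) b A F p"

definition minimal_in_hyperquadric ::
  "(real^'n \<Rightarrow> real^'n \<Rightarrow> real) \<Rightarrow> real \<Rightarrow> ('a, 'm::finite) chart set \<Rightarrow> ('a \<Rightarrow> real^'n) \<Rightarrow> bool" where
  "minimal_in_hyperquadric b k A F \<longleftrightarrow>
     (\<forall>p\<in>carrier A. F p \<in> hyperquadric b k \<and> hyperquadric_mean_curvature b A F p = 0)"

definition tangent_image ::
  "('a, 'm::finite) chart set \<Rightarrow> ('a \<Rightarrow> real^'n) \<Rightarrow> 'a \<Rightarrow> (real^'n) set" where
  "tangent_image A F p =
     (let c = chart_at A p in range (frechet_derivative (local_rep c F) (at (snd c p))))"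

definition normal_part ::
  "(real^'n \<Rightarrow> real^'n \<Rightarrow> real) \<Rightarrow> ('a, 'm::finite) chart set \<Rightarrow> ('a \<Rightarrow> real^'n) \<Rightarrow> 'a \<Rightarrow>
    real^'n \<Rightarrow> real^'n" where
  "normal_part b A F p v = v - orth_proj b (tangent_image A F p) v"

section \<open>Mean curvature flow\<close>

definition time_interval :: "ereal \<Rightarrow> real set" where
  "time_interval T = {t. 0 \<le> t \<and> ereal t < T}"

definition mcf_solution ::
  "(real^'n \<Rightarrow> real^'n \<Rightarrow> real) \<Rightarrow> ('a, 'm::finite) chart set \<Rightarrow> ('a \<Rightarrow> real^'n) \<Rightarrow> ereal \<Rightarrow>
    (real \<Rightarrow> 'a \<Rightarrow> real^'n) \<Rightarrow> bool" where
  "mcf_solution b A F0 T \<Phi> \<longleftrightarrow>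
     T > 0 \<and>
     (\<forall>(U, \<phi>)\<in>A. smooth_on (\<phi> ` U \<times> time_interval T)
        (\<lambda>(x, t). local_rep (U, \<phi>) (\<Phi> t) x)) \<and>
     (\<forall>t\<in>time_interval T. immersion A (\<Phi> t) \<and> nondegenerate_metric b A (\<Phi> t)) \<and>
     (\<forall>p\<in>carrier A. \<forall>t\<in>time_interval T.
        ((\<lambda>s. \<Phi> s p) has_vector_derivative mean_curvature b A (\<Phi> t) p)
          (at t within time_interval T)) \<and>
     (\<forall>p\<in>carrier A. \<Phi> 0 p = F0 p)"

definition homothetic_with ::
  "(real^'n \<Rightarrow> real^'n \<Rightarrow> real) \<Rightarrow> ('a, 'm::finite) chart set \<Rightarrow> ereal \<Rightarrow> (real \<Rightarrow> 'a \<Rightarrow> real^'n) \<Rightarrow>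
    (real \<Rightarrow> real) \<Rightarrow> bool" where
  "homothetic_with b A T \<Phi> c \<longleftrightarrow>
     c 0 = 1 \<and> (\<forall>t\<in>time_interval T. c t > 0) \<and>
     (\<exists>c'. \<forall>t\<in>time_interval T.
        (c has_real_derivative c' t) (at t within time_interval T) \<and>
        (\<forall>p\<in>carrier A.
           mean_curvature b A (\<Phi> t) p
             = (- (c' t / c t)) *\<^sub>R normal_part b A (\<Phi> t) p (\<Phi> t p)))"

definition homothety ::
  "(real^'n \<Rightarrow> real^'n \<Rightarrow> real) \<Rightarrow> ('a, 'm::finite) chart set \<Rightarrow> ereal \<Rightarrow> (real \<Rightarrow> 'a \<Rightarrow> real^'n) \<Rightarrow> bool"
  where
  "homothety b A T \<Phi> \<longleftrightarrow> (\<exists>c. homothetic_with b A T \<Phi> c)"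

end

theory Submission
  imports Defs
begin

text \<open>
  Write \<open>m\<close> for the dimension of the manifold, \<open>H\<close> for the mean curvature vector of an immersion
  in the flat space, and \<open>g\<close> for the induced metric. Three facts about \<open>H\<close> carry the proof. It is
  normal, by the Koszul formula for the Christoffel symbols (\<open>mean_curvature_normal\<close>). If the
  position vector \<open>F\<close> is normal, which is the case when \<open>b F F\<close> is constant, then
  \<open>b (\<partial>\<^sub>i\<partial>\<^sub>jF) F = - g\<^sub>i\<^sub>j\<close>, so that tracing gives \<open>b H F = - m\<close>
  (\<open>mean_curvature_position\<close>). For \<open>b F F = k \<noteq> 0\<close> the mean curvature vector in the hyperquadric is
  \<open>H + (m / k) F\<close> (\<open>hyperquadric_mean_curvature_eq\<close>). Hence \<open>F\<close> is minimal in the hyperquadric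
  exactly if \<open>H = - (m / k) F\<close>.

  If \<open>F\<close> is minimal, then scaling by \<open>a\<close> divides \<open>H\<close> by \<open>a\<close>, and the flow equation for
  \<open>1 / c(t) F\<close> is the ordinary differential equation \<open>(1 / c)' = - (m / k) c\<close>, which the given
  \<open>c\<close> solves on \<open>[0, \<infinity>)\<close>. Conversely, a homothetic solution satisfies at time 0 the
  equation \<open>H = - c'(0) F\<close>, since \<open>F\<close> is normal. Pairing with \<open>F\<close> gives
  \<open>c'(0) = m / k\<close>, which is minimality.

  The remaining claim is that every homothetic solution \<open>\<Phi>\<close>, with factor \<open>\<gamma>\<close>, is the one above.
  The equation only prescribes \<open>H = - a \<Phi>\<^sup>\<bottom>\<close> with \<open>a = \<gamma>' / \<gamma>\<close>, so one must see that
  the position vector \<open>\<Phi>\<close> stays normal. Let \<open>w\<^sub>i = b \<Phi> (\<partial>\<^sub>i\<Phi>)\<close>. As \<open>H = \<partial>\<^sub>t\<Phi>\<close> is normal,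
  \<open>\<partial>\<^sub>tw\<^sub>i = b \<Phi> (\<partial>\<^sub>iH)\<close>. Differentiating \<open>b H H = - a b \<Phi> H\<close> along \<open>M\<close> and inserting
  \<open>H = - a (\<Phi> - \<Phi>\<^sup>\<top>)\<close>, where \<open>\<Phi>\<^sup>\<top>\<close> is the tangential part, one obtains
  \<open>\<partial>\<^sub>tw\<^sub>i = 2 b \<Phi>\<^sup>\<top> (\<partial>\<^sub>iH)\<close>. The factor \<open>a\<close> has cancelled, so the coefficients are
  continuous in time. Since \<open>\<Phi>\<^sup>\<top>\<close> depends
  linearly on \<open>w\<close>, this is at each point of \<open>M\<close> a linear differential equation in time with zero
  initial value, and \<open>w = 0\<close> by Gronwall (\<open>position_stays_normal\<close>). Then
  \<open>\<partial>\<^sub>t(\<gamma> \<Phi>) = 0\<close> and \<open>\<partial>\<^sub>t(b \<Phi> \<Phi>) = - 2 m\<close>, so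
  \<open>\<Phi> = F / \<gamma>\<close> and \<open>k / \<gamma>\<^sup>2 = k - 2 m t\<close>, which determines \<open>\<gamma>\<close>.
\<close>

section \<open>Maps with iterated derivatives\<close>

lemma Ck_on_cong:
  assumes "Ck_on r S f" and eq: "\<And>x. x \<in> S \<Longrightarrow> g x = f x"
  shows "Ck_on r S g"
proof (cases r)
  case 0
  then show ?thesis using assms(1) continuous_on_cong[OF refl eq, of S] by simp
next
  case (Suc n)
  then obtain f' where f': "\<forall>x\<in>S. (f has_derivative f' x) (at x within S)"
      "\<forall>e\<in>Basis. Ck_on n S (\<lambda>x. f' x e)"
    using assms(1) by (simp only: Ck_on.simps) blast
  from f'(1) have "\<forall>x\<in>S. (g has_derivative f' x) (at x within S)"
    using has_derivative_transform[of _ S g f, OF _ eq] by simp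
  with f'(2) Suc show ?thesis by auto
qed

lemma Ck_on_Suc_imp_Ck_on: "Ck_on (Suc r) S f \<Longrightarrow> Ck_on r S f"
proof (induction r arbitrary: f)
  case 0
  then have "\<forall>x\<in>S. continuous (at x within S) f"
    by (auto dest: has_derivative_continuous)
  then show ?case by (simp add: continuous_on_eq_continuous_within)
next
  case (Suc r)
  from Suc.prems obtain f' where f': "\<forall>x\<in>S. (f has_derivative f' x) (at x within S)"
      "\<forall>e\<in>Basis. Ck_on (Suc r) S (\<lambda>x. f' x e)"
    unfolding Ck_on.simps(2)[of "Suc r"] by blast
  with Suc.IH have "\<forall>e\<in>Basis. Ck_on r S (\<lambda>x. f' x e)" by blast
  with f'(1) show ?case unfolding Ck_on.simps(2)[of r] by blast
qed

lemma Ck_on_scaleR: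
  "Ck_on r S f \<Longrightarrow> Ck_on r S (\<lambda>x. a *\<^sub>R f x)"
proof (induction r arbitrary: f)
  case 0
  then show ?case by (auto intro: continuous_intros)
next
  case (Suc r)
  then obtain f' where f': "\<forall>x\<in>S. (f has_derivative f' x) (at x within S)"
      "\<forall>e\<in>Basis. Ck_on r S (\<lambda>x. f' x e)"
    by auto
  have "\<forall>x\<in>S. ((\<lambda>x. a *\<^sub>R f x) has_derivative (\<lambda>v. a *\<^sub>R f' x v)) (at x within S)"
    using f'(1) by (blast intro: has_derivative_scaleR_right)
  moreover have "\<forall>e\<in>Basis. Ck_on r S (\<lambda>x. a *\<^sub>R f' x e)"
    using f'(2) Suc.IH by blast
  ultimately show ?case
    unfolding Ck_on.simps(2) by (intro exI[of _ "\<lambda>x v. a *\<^sub>R f' x v"]) simp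
qed

lemma Ck_on_has_frechet_derivative:
  assumes "open S" "Ck_on (Suc r) S f" "x \<in> S"
  shows "(f has_derivative frechet_derivative f (at x)) (at x)"
proof -
  from assms(2) obtain f' where "\<forall>x\<in>S. (f has_derivative f' x) (at x within S)"
    by auto
  then show ?thesis
    using assms(1,3) by (metis at_within_open frechet_derivative_works differentiable_def)
qed

lemma Ck_on_partial:
  fixes f :: "real^'m::finite \<Rightarrow> 'b::real_normed_vector"
  assumes "open S" "Ck_on (Suc r) S f"
  shows "Ck_on r S (partial i f)"
proof -
  obtain f' where f': "\<forall>x\<in>S. (f has_derivative f' x) (at x within S)"
      "\<forall>e\<in>Basis. Ck_on r S (\<lambda>x. f' x e)"
    using assms(2) by auto
  have "partial i f x = f' x (axis i 1)" if "x \<in> S" for x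
    using f'(1) that assms(1) by (metis at_within_open frechet_derivative_at partial_def)
  moreover have "Ck_on r S (\<lambda>x. f' x (axis i 1))"
    using f'(2) by (simp add: axis_in_Basis_iff)
  ultimately show ?thesis by (rule Ck_on_cong[rotated])
qed

section \<open>Symmetry of second derivatives\<close>

text \<open>
  The mean value theorem is applied first in direction \<open>u\<close> and then in direction \<open>v\<close>. The left
  hand side is symmetric in \<open>u\<close> and \<open>v\<close>; comparing the two orders as \<open>s\<close> tends to 0 yields the
  symmetry of the second derivative.
\<close>
lemma second_difference_mean_value:
  fixes f :: "'a::real_normed_vector \<Rightarrow> real"
  assumes s: "0 < s"
    and S: "\<And>\<sigma> \<tau>. \<lbrakk>0 \<le> \<sigma>; \<sigma> \<le> s; 0 \<le> \<tau>; \<tau> \<le> s\<rbrakk> \<Longrightarrow> z + \<sigma> *\<^sub>R u + \<tau> *\<^sub>R v \<in> S"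
    and f: "\<And>y. y \<in> S \<Longrightarrow> (f has_derivative f' y) (at y)"
    and fu: "\<And>y. y \<in> S \<Longrightarrow> ((\<lambda>y. f' y u) has_derivative fu y) (at y)"
  shows "\<exists>\<sigma> \<tau>. 0 \<le> \<sigma> \<and> \<sigma> \<le> s \<and> 0 \<le> \<tau> \<and> \<tau> \<le> s \<and>
    f (z + s *\<^sub>R u + s *\<^sub>R v) - f (z + s *\<^sub>R u) - f (z + s *\<^sub>R v) + f z
      = s\<^sup>2 * fu (z + \<sigma> *\<^sub>R u + \<tau> *\<^sub>R v) v"
proof -
  have line: "((\<lambda>\<sigma>. h (w + \<sigma> *\<^sub>R e)) has_real_derivative h' e) (at \<sigma>)"
    if "(h has_derivative h') (at (w + \<sigma> *\<^sub>R e))" for h :: "'a \<Rightarrow> real" and h' w e \<sigma>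
  proof -
    have "((\<lambda>\<sigma>. w + \<sigma> *\<^sub>R e) has_derivative (\<lambda>r. r *\<^sub>R e)) (at \<sigma>)"
      by (auto intro!: derivative_eq_intros)
    from has_derivative_compose[OF this that]
    show ?thesis
      using linear_simps(5)[OF has_derivative_bounded_linear[OF that]]
      by (simp add: has_field_derivative_def mult_commute_abs)
  qed
  define g where "g = (\<lambda>\<sigma>. f (z + s *\<^sub>R v + \<sigma> *\<^sub>R u) - f (z + \<sigma> *\<^sub>R u))"
  have "DERIV g \<sigma> :> f' (z + s *\<^sub>R v + \<sigma> *\<^sub>R u) u - f' (z + \<sigma> *\<^sub>R u) u" if "0 \<le> \<sigma>" "\<sigma> \<le> s" for \<sigma>
    unfolding g_def using S[of \<sigma> s] S[of \<sigma> 0] that s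
    by (intro DERIV_diff line f) (auto simp: algebra_simps)
  from MVT2[OF s this] obtain \<sigma> where \<sigma>: "0 < \<sigma>" "\<sigma> < s"
    "g s - g 0 = (s - 0) * (f' (z + s *\<^sub>R v + \<sigma> *\<^sub>R u) u - f' (z + \<sigma> *\<^sub>R u) u)"
    by blast
  have "DERIV (\<lambda>\<tau>. f' (z + \<sigma> *\<^sub>R u + \<tau> *\<^sub>R v) u) \<tau> :> fu (z + \<sigma> *\<^sub>R u + \<tau> *\<^sub>R v) v"
    if "0 \<le> \<tau>" "\<tau> \<le> s" for \<tau>
    by (rule line[OF fu]) (use S[of \<sigma> \<tau>] that \<sigma> in auto)
  from MVT2[OF s this] obtain \<tau> where \<tau>: "0 < \<tau>" "\<tau> < s"
    "f' (z + \<sigma> *\<^sub>R u + s *\<^sub>R v) u - f' (z + \<sigma> *\<^sub>R u + 0 *\<^sub>R v) u = (s - 0) * fu (z + \<sigma> *\<^sub>R u + \<tau> *\<^sub>R v) v"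
    by blast
  have "f (z + s *\<^sub>R u + s *\<^sub>R v) - f (z + s *\<^sub>R u) - f (z + s *\<^sub>R v) + f z = g s - g 0"
    by (simp add: g_def algebra_simps)
  also have "\<dots> = s\<^sup>2 * fu (z + \<sigma> *\<^sub>R u + \<tau> *\<^sub>R v) v"
    using \<sigma>(3) \<tau>(3) by (simp add: power2_eq_square add.commute add.left_commute)
  finally show ?thesis using \<sigma> \<tau> by (meson less_imp_le)
qed

lemma symmetric_second_derivative_real:
  fixes f :: "'a::real_normed_vector \<Rightarrow> real"
  assumes "open S" and z: "z \<in> S"
    and f: "\<And>y. y \<in> S \<Longrightarrow> (f has_derivative f' y) (at y)"
    and fu: "\<And>y. y \<in> S \<Longrightarrow> ((\<lambda>y. f' y u) has_derivative fu y) (at y)"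
    and fv: "\<And>y. y \<in> S \<Longrightarrow> ((\<lambda>y. f' y v) has_derivative fv y) (at y)"
    and cu: "continuous_on S (\<lambda>y. fu y v)" and cv: "continuous_on S (\<lambda>y. fv y u)"
  shows "fu z v = fv z u"
proof (rule ccontr)
  assume neq: "fu z v \<noteq> fv z u"
  define \<epsilon> where "\<epsilon> = \<bar>fu z v - fv z u\<bar> / 2"
  have \<epsilon>: "\<epsilon> > 0" using neq by (simp add: \<epsilon>_def)
  obtain d0 where d0: "d0 > 0" "ball z d0 \<subseteq> S"
    using assms(1) z by (auto simp: open_contains_ball)
  obtain d1 where d1: "d1 > 0" "\<And>y. y \<in> S \<Longrightarrow> dist y z < d1 \<Longrightarrow> dist (fu y v) (fu z v) < \<epsilon>"
    using cu z \<epsilon> unfolding continuous_on_iff by blast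
  obtain d2 where d2: "d2 > 0" "\<And>y. y \<in> S \<Longrightarrow> dist y z < d2 \<Longrightarrow> dist (fv y u) (fv z u) < \<epsilon>"
    using cv z \<epsilon> unfolding continuous_on_iff by blast
  define d where "d = min d0 (min d1 d2)"
  have d: "d > 0" "d \<le> d0" "d \<le> d1" "d \<le> d2" using d0 d1 d2 by (auto simp: d_def)
  define s where "s = d / (norm u + norm v + 1)"
  have N: "norm u + norm v + 1 > 0" by (simp add: add_nonneg_pos)
  have s: "s > 0" using d N by (simp add: s_def)
  have near: "dist (z + \<sigma> *\<^sub>R u + \<tau> *\<^sub>R v) z < d" if "0 \<le> \<sigma>" "\<sigma> \<le> s" "0 \<le> \<tau>" "\<tau> \<le> s" for \<sigma> \<tau>
  proof -
    have "dist (z + \<sigma> *\<^sub>R u + \<tau> *\<^sub>R v) z = norm (\<sigma> *\<^sub>R u + \<tau> *\<^sub>R v)"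
      by (simp add: dist_norm)
    also have "\<dots> \<le> \<sigma> * norm u + \<tau> * norm v"
      using norm_triangle_ineq[of "\<sigma> *\<^sub>R u" "\<tau> *\<^sub>R v"] that by simp
    also have "\<dots> \<le> s * norm u + s * norm v" using that by (intro add_mono mult_right_mono) auto
    also have "\<dots> < s * (norm u + norm v + 1)" using s by (simp add: algebra_simps)
    also have "\<dots> = d" using N by (simp add: s_def)
    finally show ?thesis .
  qed
  have inS: "z + \<sigma> *\<^sub>R u + \<tau> *\<^sub>R v \<in> S" if "0 \<le> \<sigma>" "\<sigma> \<le> s" "0 \<le> \<tau>" "\<tau> \<le> s" for \<sigma> \<tau>
    using near[OF that] d d0 by (auto simp: dist_commute subset_eq)
  have inS': "z + \<sigma> *\<^sub>R v + \<tau> *\<^sub>R u \<in> S" if "0 \<le> \<sigma>" "\<sigma> \<le> s" "0 \<le> \<tau>" "\<tau> \<le> s" for \<sigma> \<tau>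
    using inS[of \<tau> \<sigma>] that by (simp add: algebra_simps)
  define \<Delta> where "\<Delta> = f (z + s *\<^sub>R u + s *\<^sub>R v) - f (z + s *\<^sub>R u) - f (z + s *\<^sub>R v) + f z"
  obtain \<sigma> \<tau> where 1: "0 \<le> \<sigma>" "\<sigma> \<le> s" "0 \<le> \<tau>" "\<tau> \<le> s" "\<Delta> = s\<^sup>2 * fu (z + \<sigma> *\<^sub>R u + \<tau> *\<^sub>R v) v"
    using second_difference_mean_value[OF s inS f fu] unfolding \<Delta>_def by blast
  obtain \<sigma>' \<tau>' where 2: "0 \<le> \<sigma>'" "\<sigma>' \<le> s" "0 \<le> \<tau>'" "\<tau>' \<le> s" "\<Delta> = s\<^sup>2 * fv (z + \<sigma>' *\<^sub>R v + \<tau>' *\<^sub>R u) u"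
    using second_difference_mean_value[OF s inS' f fv] unfolding \<Delta>_def
    by (auto simp: algebra_simps)
  have eq: "fu (z + \<sigma> *\<^sub>R u + \<tau> *\<^sub>R v) v = fv (z + \<tau>' *\<^sub>R u + \<sigma>' *\<^sub>R v) u"
    using 1(5) 2(5) s by (simp add: algebra_simps)
  have "dist (fu (z + \<sigma> *\<^sub>R u + \<tau> *\<^sub>R v) v) (fu z v) < \<epsilon>"
    using d1(2)[OF inS[OF 1(1-4)]] near[OF 1(1-4)] d by simp
  moreover have "dist (fv (z + \<tau>' *\<^sub>R u + \<sigma>' *\<^sub>R v) u) (fv z u) < \<epsilon>"
    using d2(2)[OF inS[OF 2(3,4,1,2)]] near[OF 2(3,4,1,2)] d by simp
  ultimately have "\<bar>fu z v - fv z u\<bar> < 2 * \<epsilon>" unfolding eq dist_real_def by linarith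
  then show False by (simp add: \<epsilon>_def)
qed

lemma symmetric_second_derivative:
  fixes f :: "'a::real_normed_vector \<Rightarrow> 'b::euclidean_space"
  assumes "open S" "z \<in> S"
    and f: "\<And>y. y \<in> S \<Longrightarrow> (f has_derivative f' y) (at y)"
    and fu: "\<And>y. y \<in> S \<Longrightarrow> ((\<lambda>y. f' y u) has_derivative fu y) (at y)"
    and fv: "\<And>y. y \<in> S \<Longrightarrow> ((\<lambda>y. f' y v) has_derivative fv y) (at y)"
    and cu: "continuous_on S (\<lambda>y. fu y v)" and cv: "continuous_on S (\<lambda>y. fv y u)"
  shows "fu z v = fv z u"
proof (rule euclidean_eqI)
  fix e :: 'b
  show "fu z v \<bullet> e = fv z u \<bullet> e"
    by (rule symmetric_second_derivative_real[OF assms(1,2),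
          where f = "\<lambda>y. f y \<bullet> e" and f' = "\<lambda>y h. f' y h \<bullet> e"
          and fu = "\<lambda>y h. fu y h \<bullet> e" and fv = "\<lambda>y h. fv y h \<bullet> e"])
      (auto intro!: has_derivative_inner_left f fu fv continuous_on_inner cu cv)
qed

lemma partial_commute:
  fixes f :: "real^'m::finite \<Rightarrow> 'b::euclidean_space"
  assumes S: "open S" and f: "Ck_on (Suc (Suc 0)) S f" and x: "x \<in> S"
  shows "partial i (partial j f) x = partial j (partial i f) x"
proof -
  note 1 = Ck_on_has_frechet_derivative[OF S f]
  note 2 = Ck_on_has_frechet_derivative[OF S Ck_on_partial[OF S f]]
  have 3: "continuous_on S (partial i (partial j f))" for i j
    using Ck_on_partial[OF S Ck_on_partial[OF S f]] by simp
  show ?thesis unfolding partial_def[of i "partial j f"] partial_def[of j "partial i f"]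
    by (rule symmetric_second_derivative[OF S x, where f = f
          and f' = "\<lambda>y. frechet_derivative f (at y)"
          and fu = "\<lambda>y. frechet_derivative (partial j f) (at y)"
          and fv = "\<lambda>y. frechet_derivative (partial i f) (at y)"])
      (use 1 2 3 in \<open>simp_all add: partial_def[abs_def]\<close>)
qed

section \<open>Linear differential inequalities\<close>

text \<open>
  The function \<open>|w(s)|\<^sup>2 exp (- 2 K s)\<close> is nonincreasing. Its initial value is 0.
\<close>
lemma gronwall_zero:
  fixes w :: "real \<Rightarrow> 'a::real_inner"
  assumes cont: "continuous_on {0..t} w" and w0: "w 0 = 0" and "0 \<le> t"
    and w': "\<And>s. \<lbrakk>0 < s; s < t\<rbrakk> \<Longrightarrow> (w has_vector_derivative w' s) (at s)"
    and bound: "\<And>s. \<lbrakk>0 < s; s < t\<rbrakk> \<Longrightarrow> norm (w' s) \<le> K * norm (w s)"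
  shows "w t = 0"
proof (cases "t = 0")
  case False
  with \<open>0 \<le> t\<close> have t: "0 < t" by simp
  define y where "y = (\<lambda>s. (w s \<bullet> w s) * exp (- (2 * K * s)))"
  have "\<exists>d. DERIV y s :> d \<and> d \<le> 0" if "0 < s" "s < t" for s
  proof (intro exI conjI)
    have "((\<lambda>s. w s \<bullet> w s) has_derivative (\<lambda>h. w s \<bullet> (h *\<^sub>R w' s) + (h *\<^sub>R w' s) \<bullet> w s)) (at s)"
      using has_derivative_inner[OF w'[OF that, unfolded has_vector_derivative_def]
          w'[OF that, unfolded has_vector_derivative_def]] .
    then have d: "DERIV (\<lambda>s. w s \<bullet> w s) s :> 2 * (w s \<bullet> w' s)"
      unfolding has_field_derivative_def
      by (rule has_derivative_eq_rhs) (auto simp: inner_commute algebra_simps)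
    have "DERIV (\<lambda>s. exp (- (2 * K * s))) s :> exp (- (2 * K * s)) * (- (2 * K))"
      by (auto intro!: derivative_eq_intros)
    from DERIV_mult[OF d this]
    show "DERIV y s :> 2 * (w s \<bullet> w' s - K * (w s \<bullet> w s)) * exp (- (2 * K * s))"
      unfolding y_def by (rule DERIV_cong) (simp add: algebra_simps)
    have "w s \<bullet> w' s \<le> norm (w s) * norm (w' s)" by (rule norm_cauchy_schwarz)
    also have "\<dots> \<le> norm (w s) * (K * norm (w s))"
      by (intro mult_left_mono bound that) simp
    also have "\<dots> = K * (w s \<bullet> w s)" by (simp add: dot_square_norm power2_eq_square)
    finally show "2 * (w s \<bullet> w' s - K * (w s \<bullet> w s)) * exp (- (2 * K * s)) \<le> 0"
      by (simp add: mult_nonpos_nonneg)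
  qed
  moreover have "continuous_on {0..t} y" unfolding y_def by (intro continuous_intros cont)
  ultimately have "y t \<le> y 0" by (rule DERIV_nonpos_imp_decreasing_open[OF \<open>0 \<le> t\<close>])
  then have "w t \<bullet> w t \<le> 0" by (simp add: y_def w0 mult_le_0_iff)
  then show ?thesis by (metis inner_gt_zero_iff not_le)
qed (use w0 in simp)

text \<open>
  The quotient of the two norms is homogeneous of degree 0 in \<open>v\<close>, hence bounded by its maximum on the
  compact product of \<open>I\<close> with the unit sphere. With \<open>g\<close> the induced metric at a point for varying
  time, this bounds the tangential part of a vector by its products with the coordinate fields
  without inverting the metric.
\<close>
lemma linear_family_bound:
  fixes g B :: "real \<Rightarrow> 'a::euclidean_space \<Rightarrow> 'b::real_normed_vector"
  assumes "compact I"
    and lin: "\<And>t. t \<in> I \<Longrightarrow> linear (g t)" "\<And>t. t \<in> I \<Longrightarrow> linear (B t)"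
    and inj: "\<And>t v. \<lbrakk>t \<in> I; g t v = 0\<rbrakk> \<Longrightarrow> v = 0"
    and cont: "continuous_on (I \<times> UNIV) (\<lambda>(t, v). g t v)" "continuous_on (I \<times> UNIV) (\<lambda>(t, v). B t v)"
  obtains K where "\<And>t v. t \<in> I \<Longrightarrow> norm (B t v) \<le> K * norm (g t v)"
proof -
  define C :: "(real \<times> 'a) set" where "C = I \<times> sphere 0 1"
  have "compact C" unfolding C_def using assms(1) by (intro compact_Times) auto
  moreover have "continuous_on C (\<lambda>z. norm (B (fst z) (snd z)) / norm (g (fst z) (snd z)))"
  proof (intro continuous_intros)
    have sub: "C \<subseteq> I \<times> UNIV" by (auto simp: C_def)
    show "continuous_on C (\<lambda>z. B (fst z) (snd z))" "continuous_on C (\<lambda>z. g (fst z) (snd z))"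
      using continuous_on_subset[OF cont(1) sub] continuous_on_subset[OF cont(2) sub]
      by (simp_all add: case_prod_unfold)
    show "\<forall>z\<in>C. norm (g (fst z) (snd z)) \<noteq> 0" using inj by (fastforce simp: C_def)
  qed
  ultimately have "bounded ((\<lambda>z. norm (B (fst z) (snd z)) / norm (g (fst z) (snd z))) ` C)"
    by (intro compact_imp_bounded compact_continuous_image)
  then obtain K where K: "\<And>t v. t \<in> I \<Longrightarrow> norm v = 1 \<Longrightarrow> norm (B t v) / norm (g t v) \<le> K"
    unfolding bounded_iff C_def by fastforce
  have "norm (B t v) \<le> K * norm (g t v)" if t: "t \<in> I" for t v
  proof (cases "v = 0")
    case True
    then show ?thesis using linear_0[OF lin(1)[OF t]] linear_0[OF lin(2)[OF t]] by simp
  next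
    case False
    define u where "u = (1 / norm v) *\<^sub>R v"
    have u: "norm u = 1" "v = norm v *\<^sub>R u" using False by (auto simp: u_def)
    have "g t u \<noteq> 0" using inj[OF t, of u] u(1) by force
    then have "norm (B t u) \<le> K * norm (g t u)" using K[OF t u(1)] by (simp add: field_simps)
    then have "norm v * norm (B t u) \<le> norm v * (K * norm (g t u))" by (intro mult_left_mono) auto
    moreover have "norm (B t v) = norm v * norm (B t u)" "norm (g t v) = norm v * norm (g t u)"
      using linear_scale[OF lin(2)[OF t], of "norm v" u] linear_scale[OF lin(1)[OF t], of "norm v" u] u(2)
      by simp_all
    ultimately show ?thesis by (simp add: algebra_simps)
  qed
  then show ?thesis using that by blast
qed

section \<open>Symmetric bilinear forms and orthogonal projections\<close>

lemma linear_eq_sum_axis: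
  fixes L :: "real^'m::finite \<Rightarrow> 'b::real_vector"
  assumes "linear L"
  shows "L v = (\<Sum>i\<in>UNIV. v $ i *\<^sub>R L (axis i 1))"
proof -
  have "L v = L (\<Sum>i\<in>UNIV. v $ i *\<^sub>R axis i 1)"
    using basis_expansion[of v] by (simp add: scalar_mult_eq_scaleR)
  also have "\<dots> = (\<Sum>i\<in>UNIV. v $ i *\<^sub>R L (axis i 1))"
    by (simp add: linear_sum[OF assms] linear_scale[OF assms])
  finally show ?thesis .
qed

lemma matrix_inv_eqI:
  fixes M N :: "real^'m::finite^'m"
  assumes "M ** N = mat 1"
  shows "matrix_inv M = N"
proof -
  have NM: "N ** M = mat 1" using assms matrix_left_right_inverse by blast
  have "M ** matrix_inv M = mat 1 \<and> matrix_inv M ** M = mat 1"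
    unfolding matrix_inv_def by (rule someI[of _ N]) (use assms NM in simp)
  then show ?thesis by (metis NM matrix_mul_assoc matrix_mul_lid matrix_mul_rid)
qed

locale symmetric_form =
  fixes b :: "real^'n \<Rightarrow> real^'n \<Rightarrow> real"
  assumes bilinear: "bilinear b" and sym: "b x y = b y x"
begin

sublocale bounded_bilinear b
  using bilinear by (simp add: bilinear_conv_bounded_bilinear)

lemma orth_proj_eqI:
  assumes W: "subspace W" "\<And>d. \<lbrakk>d \<in> W; \<And>u. u \<in> W \<Longrightarrow> b d u = 0\<rbrakk> \<Longrightarrow> d = 0"
    and w: "w \<in> W" "\<And>u. u \<in> W \<Longrightarrow> b (v - w) u = 0"
  shows "orth_proj b W v = w"
  unfolding orth_proj_def
proof (rule the_equality)
  fix w' assume w': "w' \<in> W \<and> (\<forall>u\<in>W. b (v - w') u = 0)"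
  have "w' - w = 0"
  proof (rule W(2))
    show "w' - w \<in> W" using w' w(1) W(1) by (simp add: subspace_diff)
    show "b (w' - w) u = 0" if "u \<in> W" for u
      using w(2)[OF that] w' that by (simp add: diff_left)
  qed
  then show "w' = w" by simp
qed (use w in blast)

text \<open>
  The linear map sending \<open>w\<close> to the products of \<open>L w\<close> with the \<open>L (axis i 1)\<close> is injective by
  nondegeneracy, hence surjective for reasons of dimension; this produces the projection of every
  \<open>v\<close>, although \<open>b\<close> may be indefinite.
\<close>
lemma orth_proj_range:
  fixes L :: "real^'m::finite \<Rightarrow> real^'n"
  assumes L: "linear L" and nondeg: "nondegenerate (\<lambda>v w. b (L v) (L w))"
  obtains w where "orth_proj b (range L) v = L w" "\<And>u. b (v - L w) (L u) = 0"
proof -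
  define T :: "real^'m \<Rightarrow> real^'m" where "T = (\<lambda>w. \<chi> i. b (L w) (L (axis i 1)))"
  have lin: "linear (\<lambda>u. b y (L u))" for y
    by (rule linearI) (simp_all add: linear_add[OF L] linear_scale[OF L] add_right scaleR_right)
  have zero: "b y (L u) = 0" if "\<And>i. b y (L (axis i 1)) = 0" for y u
    by (subst linear_eq_sum_axis[OF lin]) (simp add: that)
  have T: "linear T"
    by (rule linearI) (simp_all add: T_def vec_eq_iff linear_add[OF L] linear_scale[OF L] add_left scaleR_left)
  have "w = 0" if "T w = 0" for w
  proof -
    have "b (L w) (L u) = 0" for u
      by (rule zero) (use that in \<open>simp add: T_def vec_eq_iff\<close>)
    then show ?thesis using nondeg by (simp add: nondegenerate_def)
  qed
  then have "inj T" using T by (simp add: linear_injective_0)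
  then have "surj T" using T linear_injective_imp_surjective by blast
  then obtain w where w: "T w = (\<chi> i. b v (L (axis i 1)))" by (metis surjD)
  have orth: "b (v - L w) (L u) = 0" for u
    by (rule zero) (use w in \<open>simp add: T_def vec_eq_iff diff_left\<close>)
  have "orth_proj b (range L) v = L w"
  proof (rule orth_proj_eqI)
    show "subspace (range L)" using L subspace_UNIV linear_subspace_image by blast
    show "d = 0" if "d \<in> range L" "\<And>u. u \<in> range L \<Longrightarrow> b d u = 0" for d
      using that nondeg linear_0[OF L] unfolding nondegenerate_def by blast
  qed (use orth in auto)
  then show ?thesis using orth that by blast
qed

lemma orth_proj_hyperplane:
  assumes nondeg: "nondegenerate b" and y: "b y y \<noteq> 0"
  shows "orth_proj b {v. b y v = 0} v = v - (b v y / b y y) *\<^sub>R y"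
proof (rule orth_proj_eqI)
  show "subspace {v. b y v = 0}"
    by (auto simp: subspace_def add_right scaleR_right zero_right)
  show "d = 0" if d: "d \<in> {v. b y v = 0}" "\<And>u. u \<in> {v. b y v = 0} \<Longrightarrow> b d u = 0" for d
  proof -
    have "b d x = 0" for x
    proof -
      have "b d (x - (b y x / b y y) *\<^sub>R y) = 0"
        using y by (intro d(2)) (simp add: diff_right scaleR_right)
      then show ?thesis using d(1) by (simp add: diff_right scaleR_right sym[of d y])
    qed
    then show ?thesis using nondeg by (simp add: nondegenerate_def)
  qed
qed (use y in \<open>auto simp: diff_right scaleR_right scaleR_left sym[of v y]\<close>)

end

section \<open>Extrinsic geometry in one chart\<close>

lemma frechet_derivative_cong_open:
  assumes "open V" "x \<in> V" "\<And>y. y \<in> V \<Longrightarrow> f y = g y"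
  shows "frechet_derivative f (at x) = frechet_derivative g (at x)"
proof -
  have "(f has_derivative D) (at x) \<longleftrightarrow> (g has_derivative D) (at x)" for D
    using has_derivative_transform_within_open[of _ D x UNIV V] assms by metis
  then show ?thesis by (simp add: frechet_derivative_def)
qed

lemma partial_cong:
  assumes "open V" "x \<in> V" "\<And>y. y \<in> V \<Longrightarrow> f y = g y"
  shows "partial i f x = partial i g x"
  unfolding partial_def by (simp add: frechet_derivative_cong_open[OF assms])

lemma partial_scaleR:
  assumes "(f has_derivative D) (at x)"
  shows "partial i (\<lambda>y. a *\<^sub>R f y) x = a *\<^sub>R partial i f x"
  unfolding partial_def
  using frechet_derivative_at[OF assms] frechet_derivative_at[OF has_derivative_scaleR_right[OF assms]]
  by metis

definition patch_curvature ::
  "(real^'n \<Rightarrow> real^'n \<Rightarrow> real^'n) \<Rightarrow> (real^'n \<Rightarrow> real^'n \<Rightarrow> real) \<Rightarrow> (real^'m::finite \<Rightarrow> real^'n) \<Rightarrow>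
    real^'m \<Rightarrow> real^'n" where
  "patch_curvature P b f x =
     (\<Sum>i\<in>UNIV. \<Sum>j\<in>UNIV. gram_inv b f x $ i $ j *\<^sub>R second_fundamental P b f x i j)"

text \<open>
  Mean curvature is local. This identifies the curvatures of two maps that agree on the manifold only,
  since outside the chart domains their values are arbitrary.
\<close>
lemma patch_curvature_cong:
  assumes V: "open V" "x \<in> V" and eq: "\<And>y. y \<in> V \<Longrightarrow> f y = g y"
  shows "patch_curvature P b f x = patch_curvature P b g x"
proof -
  have p: "partial i f y = partial i g y" if "y \<in> V" for i y
    by (rule partial_cong[OF V(1) that eq])
  have pp: "partial i (partial j f) x = partial i (partial j g) x" for i j
    by (rule partial_cong[OF V p])
  have g: "gram b f y = gram b g y" if "y \<in> V" for y
    by (simp add: gram_def pullback_def frechet_derivative_cong_open[OF V(1) that eq])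
  have pg: "partial i (\<lambda>y. gram b f y $ j $ r) x = partial i (\<lambda>y. gram b g y $ j $ r) x" for i j r
    by (rule partial_cong[OF V]) (simp add: g)
  show ?thesis
    by (simp add: patch_curvature_def second_fundamental_def christoffel_def gram_inv_def
        g[OF V(2)] pg pp p[OF V(2)] eq[OF V(2)])
qed

text \<open>
  The local representative of an immersion with nondegenerate induced metric. Continuity of the
  second derivatives makes them commute in the Koszul formula.
\<close>
locale immersed_patch = symmetric_form b for b :: "real^'n \<Rightarrow> real^'n \<Rightarrow> real" +
  fixes V :: "(real^'m::finite) set" and f :: "real^'m \<Rightarrow> real^'n"
  assumes V: "open V"
    and C2: "Ck_on (Suc (Suc 0)) V f"
    and nondeg: "x \<in> V \<Longrightarrow> nondegenerate (pullback b f x)"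
begin

lemmas has_derivative = Ck_on_has_frechet_derivative[OF V C2]

lemma linear_derivative: "x \<in> V \<Longrightarrow> linear (frechet_derivative f (at x))"
  using has_derivative has_derivative_linear by blast

lemma derivative_eq_sum_partial:
  "x \<in> V \<Longrightarrow> frechet_derivative f (at x) v = (\<Sum>i\<in>UNIV. v $ i *\<^sub>R partial i f x)"
  using linear_eq_sum_axis[OF linear_derivative] by (simp add: partial_def)

lemma gram_sym: "gram b f x $ i $ j = gram b f x $ j $ i"
  by (simp add: gram_def pullback_def sym)

lemma gram_partial: "gram b f x $ i $ j = b (partial i f x) (partial j f x)"
  by (simp add: gram_def pullback_def partial_def)

lemma gram_gram_inv:
  assumes "x \<in> V"
  shows "gram b f x ** gram_inv b f x = mat 1" "gram_inv b f x ** gram b f x = mat 1"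
proof -
  have "v = 0" if v: "gram b f x *v v = 0" for v
  proof -
    have "pullback b f x v w = 0" for w
    proof -
      have "b (frechet_derivative f (at x) v) (partial i f x) = 0" for i
      proof -
        have "b (frechet_derivative f (at x) v) (partial i f x) = (gram b f x *v v) $ i"
          by (simp add: derivative_eq_sum_partial[OF assms] matrix_vector_mult_def gram_partial
              sum_left scaleR_left sym[of "partial i f x"] mult.commute)
        then show ?thesis using v by simp
      qed
      then show ?thesis
        by (simp add: pullback_def derivative_eq_sum_partial[OF assms, of w] sum_right scaleR_right)
    qed
    then show ?thesis using nondeg[OF assms] by (simp add: nondegenerate_def)
  qed
  then obtain N where "N ** gram b f x = mat 1" using matrix_left_invertible_ker by blast
  moreover from this have "gram b f x ** N = mat 1" using matrix_left_right_inverse by blast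
  moreover from this have "gram_inv b f x = N" unfolding gram_inv_def by (rule matrix_inv_eqI)
  ultimately show "gram b f x ** gram_inv b f x = mat 1" "gram_inv b f x ** gram b f x = mat 1"
    by simp_all
qed

lemma partial_gram:
  assumes "x \<in> V"
  shows "partial i (\<lambda>y. gram b f y $ j $ r) x
    = b (partial j f x) (partial i (partial r f) x) + b (partial i (partial j f) x) (partial r f x)"
proof -
  note d = Ck_on_has_frechet_derivative[OF V Ck_on_partial[OF V C2] assms]
  show ?thesis
    unfolding gram_partial partial_def[of i]
    by (subst frechet_derivative_at[OF FDERIV[OF d d], symmetric]) (rule refl)
qed

text \<open>
  By symmetry of second derivatives the three derivatives of the metric in the Koszul formula add up
  to twice a single product.
\<close>
lemma christoffel_eq:
  assumes "x \<in> V"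
  shows "christoffel b f x l i j =
    (\<Sum>r\<in>UNIV. gram_inv b f x $ l $ r * b (partial i (partial j f) x) (partial r f x))"
  unfolding christoffel_def sum_distrib_left
proof (rule sum.cong[OF refl])
  fix r
  note com = partial_commute[OF V C2 assms]
  have "partial i (\<lambda>y. gram b f y $ j $ r) x + partial j (\<lambda>y. gram b f y $ i $ r) x
      - partial r (\<lambda>y. gram b f y $ i $ j) x = 2 * b (partial i (partial j f) x) (partial r f x)"
    unfolding partial_gram[OF assms] com[of j i] com[of r i] com[of r j]
    using sym[of "partial i f x" "partial j (partial r f) x"] sym[of "partial j f x" "partial i (partial r f) x"]
    by simp
  then show "1/2 * (gram_inv b f x $ l $ r * (partial i (\<lambda>y. gram b f y $ j $ r) x
      + partial j (\<lambda>y. gram b f y $ i $ r) x - partial r (\<lambda>y. gram b f y $ i $ j) x))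
    = gram_inv b f x $ l $ r * b (partial i (partial j f) x) (partial r f x)"
    by simp
qed

abbreviation "II \<equiv> second_fundamental (\<lambda>y v. v) b f"
abbreviation "H \<equiv> patch_curvature (\<lambda>y v. v) b f"

text \<open>
  The Christoffel symbols are the coefficients of the tangential part of \<open>\<partial>\<^sub>i\<partial>\<^sub>jf\<close>, so subtracting
  them leaves a normal vector.
\<close>
lemma second_fundamental_normal:
  assumes "x \<in> V"
  shows "b (II x i j) (partial s f x) = 0"
proof -
  let ?B = "\<lambda>r. b (partial i (partial j f) x) (partial r f x)"
  have "(\<Sum>l\<in>UNIV. christoffel b f x l i j * gram b f x $ l $ s)
      = (\<Sum>r\<in>UNIV. (\<Sum>l\<in>UNIV. gram b f x $ s $ l * gram_inv b f x $ l $ r) * ?B r)"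
    unfolding christoffel_eq[OF assms] sum_distrib_right
    by (subst sum.swap) (simp add: gram_sym[of x _ s] mult_ac)
  also have "\<dots> = (\<Sum>r\<in>UNIV. (gram b f x ** gram_inv b f x) $ s $ r * ?B r)"
    by (simp add: matrix_matrix_mult_def)
  also have "\<dots> = ?B s"
    by (simp add: gram_gram_inv[OF assms] mat_def if_distrib[of "\<lambda>u. u * _"] cong: if_cong)
  finally show ?thesis
    by (simp add: second_fundamental_def diff_left sum_left scaleR_left gram_partial)
qed

lemma curvature_normal_partial:
  assumes "x \<in> V"
  shows "b (H x) (partial s f x) = 0"
  by (simp add: patch_curvature_def sum_left scaleR_left second_fundamental_normal[OF assms])

lemma curvature_normal:
  assumes "x \<in> V"
  shows "b (H x) (frechet_derivative f (at x) v) = 0"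
  by (simp add: derivative_eq_sum_partial[OF assms] sum_right scaleR_right curvature_normal_partial[OF assms])

lemma trace_gram:
  assumes "x \<in> V"
  shows "(\<Sum>i\<in>UNIV. \<Sum>j\<in>UNIV. gram_inv b f x $ i $ j * gram b f x $ i $ j) = real CARD('m)"
proof -
  have "(\<Sum>j\<in>UNIV. gram_inv b f x $ i $ j * gram b f x $ i $ j) = 1" for i
  proof -
    have "(\<Sum>j\<in>UNIV. gram_inv b f x $ i $ j * gram b f x $ i $ j)
      = (gram_inv b f x ** gram b f x) $ i $ i"
      by (simp add: matrix_matrix_mult_def gram_sym[of x i])
    then show ?thesis by (simp add: gram_gram_inv[OF assms] mat_def)
  qed
  then show ?thesis by simp
qed

text \<open>
  Differentiate \<open>b f (\<partial>\<^sub>jf) = 0\<close> in direction \<open>i\<close>.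
\<close>
lemma second_derivative_position:
  assumes "x \<in> V" and normal: "\<And>y i. y \<in> V \<Longrightarrow> b (f y) (partial i f y) = 0"
  shows "b (partial i (partial j f) x) (f x) = - gram b f x $ i $ j"
proof -
  note d = has_derivative[OF assms(1)]
  note dd = Ck_on_has_frechet_derivative[OF V Ck_on_partial[OF V C2] assms(1)]
  have "((\<lambda>y. b (f y) (partial j f y)) has_derivative (\<lambda>v. 0)) (at x)"
    by (rule has_derivative_transform_within_open[OF has_derivative_const V assms(1)])
      (simp add: normal)
  from has_derivative_unique[OF this FDERIV[OF d dd[of j]]]
  have "b (f x) (partial i (partial j f) x) + b (partial i f x) (partial j f x) = 0"
    unfolding partial_def[of i] by metis
  then show ?thesis by (simp add: gram_partial sym[of _ "f x"])
qed

text \<open>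
  Tracing \<open>b (\<partial>\<^sub>i\<partial>\<^sub>jf) f = - g\<^sub>i\<^sub>j\<close> with the inverse metric gives minus the trace of the identity;
  the Christoffel terms are tangential and do not contribute.
\<close>
lemma curvature_position:
  assumes "x \<in> V" and normal: "\<And>y i. y \<in> V \<Longrightarrow> b (f y) (partial i f y) = 0"
  shows "b (H x) (f x) = - real CARD('m)"
proof -
  have "b (II x i j) (f x) = - gram b f x $ i $ j" for i j
    using normal[OF assms(1)] second_derivative_position[OF assms, of i j]
    by (simp add: second_fundamental_def diff_right sum_right scaleR_right sym[of _ "f x"])
  then have "b (H x) (f x) = - (\<Sum>i\<in>UNIV. \<Sum>j\<in>UNIV. gram_inv b f x $ i $ j * gram b f x $ i $ j)"
    by (simp add: patch_curvature_def sum_left scaleR_left sum_negf)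
  then show ?thesis by (simp add: trace_gram[OF assms(1)])
qed

text \<open>
  The two second fundamental tensors differ by the component of \<open>\<partial>\<^sub>i\<partial>\<^sub>jf\<close> along the position
  vector, which is \<open>- g\<^sub>i\<^sub>j / k\<close> times \<open>f\<close>.
\<close>
lemma hyperquadric_curvature:
  assumes "nondegenerate b" and x: "x \<in> V" and k: "b (f x) (f x) = k" "k \<noteq> 0"
    and normal: "\<And>y i. y \<in> V \<Longrightarrow> b (f y) (partial i f y) = 0"
  shows "patch_curvature (\<lambda>y. orth_proj b {v. b y v = 0}) b f x = H x + (real CARD('m) / k) *\<^sub>R f x"
proof -
  have "second_fundamental (\<lambda>y. orth_proj b {v. b y v = 0}) b f x i j
      = II x i j + (gram b f x $ i $ j / k) *\<^sub>R f x" for i j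
    using k second_derivative_position[OF x normal]
    by (simp add: second_fundamental_def orth_proj_hyperplane[OF assms(1)])
  then have "patch_curvature (\<lambda>y. orth_proj b {v. b y v = 0}) b f x
     = H x + (\<Sum>i\<in>UNIV. \<Sum>j\<in>UNIV. ((gram_inv b f x $ i $ j * gram b f x $ i $ j) / k) *\<^sub>R f x)"
    by (simp add: patch_curvature_def scaleR_add_right sum.distrib)
  also have "(\<Sum>i\<in>UNIV. \<Sum>j\<in>UNIV. ((gram_inv b f x $ i $ j * gram b f x $ i $ j) / k) *\<^sub>R f x)
     = (real CARD('m) / k) *\<^sub>R f x"
    by (simp add: trace_gram[OF x, symmetric] scaleR_sum_left sum_divide_distrib)
  finally show ?thesis .
qed

lemma derivative_scaleR:
  assumes "x \<in> V"
  shows "frechet_derivative (\<lambda>y. a *\<^sub>R f y) (at x) v = a *\<^sub>R frechet_derivative f (at x) v"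
  using frechet_derivative_at[OF has_derivative_scaleR_right[OF has_derivative[OF assms]]] by metis

lemma immersed_patch_scaleR:
  assumes "a \<noteq> 0"
  shows "immersed_patch b V (\<lambda>y. a *\<^sub>R f y)"
proof
  show "open V" by (rule V)
  show "Ck_on (Suc (Suc 0)) V (\<lambda>y. a *\<^sub>R f y)" by (rule Ck_on_scaleR[OF C2])
  show "nondegenerate (pullback b (\<lambda>y. a *\<^sub>R f y) x)" if "x \<in> V" for x
    using nondeg[OF that] assms
    by (simp add: nondegenerate_def pullback_def derivative_scaleR[OF that] scaleR_left scaleR_right)
qed

lemma curvature_scaleR:
  assumes "a \<noteq> 0" and x: "x \<in> V"
  shows "patch_curvature (\<lambda>y v. v) b (\<lambda>y. a *\<^sub>R f y) x = (1 / a) *\<^sub>R H x"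
proof -
  let ?h = "\<lambda>y. a *\<^sub>R f y"
  interpret scaled: immersed_patch b V ?h by (rule immersed_patch_scaleR[OF assms(1)])
  have p: "partial i ?h y = a *\<^sub>R partial i f y" if "y \<in> V" for i y
    by (rule partial_scaleR[OF has_derivative[OF that]])
  have pp: "partial i (partial j ?h) x = a *\<^sub>R partial i (partial j f) x" for i j
  proof -
    have "partial i (partial j ?h) x = partial i (\<lambda>y. a *\<^sub>R partial j f y) x"
      by (rule partial_cong[OF V x p])
    also have "\<dots> = a *\<^sub>R partial i (partial j f) x"
      by (rule partial_scaleR[OF Ck_on_has_frechet_derivative[OF V Ck_on_partial[OF V C2] x]])
    finally show ?thesis .
  qed
  have "gram_inv b ?h x = (1 / a\<^sup>2) *\<^sub>R gram_inv b f x"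
    unfolding gram_inv_def[of b ?h]
  proof (rule matrix_inv_eqI)
    have "gram b ?h x = a\<^sup>2 *\<^sub>R gram b f x"
      by (simp add: vec_eq_iff scaled.gram_partial gram_partial p[OF x] scaleR_left scaleR_right power2_eq_square)
    then show "gram b ?h x ** ((1 / a\<^sup>2) *\<^sub>R gram_inv b f x) = mat 1"
      using gram_gram_inv(1)[OF x] assms(1)
      by (simp add: matrix_scaleR_vector_ac scalar_matrix_assoc matrix_scalar_ac)
  qed
  then have g: "gram_inv b ?h x $ i $ j = gram_inv b f x $ i $ j / a\<^sup>2" for i j
    by simp
  have c: "christoffel b ?h x l i j = christoffel b f x l i j" for l i j
    using assms(1)
    by (simp add: scaled.christoffel_eq[OF x] christoffel_eq[OF x] g p[OF x] pp scaleR_left scaleR_right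
        power2_eq_square)
  have "scaled.II x i j = a *\<^sub>R II x i j" for i j
    by (simp add: second_fundamental_def c p[OF x] pp scaleR_diff_right scaleR_sum_right mult.commute)
  then show ?thesis
    using assms(1) by (simp add: patch_curvature_def g scaleR_sum_right power2_eq_square)
qed

end

section \<open>Maps on the product of a chart with a time interval\<close>

text \<open>
  The factor \<open>C\<close> and the exponent \<open>q\<close> are arbitrary because the time derivative of the family belongs
  to the same class, with exponent \<open>q - 1\<close>; this is what makes the induction on \<open>r\<close> work.
\<close>
lemma Ck_on_powr_scaleR:
  fixes f :: "'a::euclidean_space \<Rightarrow> 'b::real_normed_vector"
  assumes pos: "\<And>t. t \<in> J \<Longrightarrow> 0 < \<alpha> + \<beta> * t"
  shows "Ck_on r S f \<Longrightarrow> Ck_on r (S \<times> J) (\<lambda>z. (C * (\<alpha> + \<beta> * snd z) powr q) *\<^sub>R f (fst z))"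
proof (induction r arbitrary: f C q)
  case 0
  then have "continuous_on S f" by simp
  then have "continuous_on (S \<times> J) (\<lambda>z. f (fst z))"
    by (rule continuous_on_compose2[of S f, OF _ continuous_on_fst[OF continuous_on_id]]) auto
  moreover have "\<forall>z\<in>S \<times> J. \<alpha> + \<beta> * snd z \<noteq> 0" using pos by force
  ultimately show ?case by (auto intro!: continuous_intros)
next
  case (Suc r)
  then obtain f' where f': "\<forall>x\<in>S. (f has_derivative f' x) (at x within S)"
      "\<forall>e\<in>Basis. Ck_on r S (\<lambda>x. f' x e)"
    by (simp only: Ck_on.simps) blast
  define s where "s = (\<lambda>t. C * (\<alpha> + \<beta> * t) powr q)"
  define s' where "s' = (\<lambda>t. (C * (q * \<beta>)) * (\<alpha> + \<beta> * t) powr (q - 1))"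
  have s: "(s has_real_derivative s' t) (at t)" if "t \<in> J" for t
    unfolding s_def s'_def using pos[OF that]
    by (auto intro!: derivative_eq_intros)
  let ?D = "\<lambda>z h. s (snd z) *\<^sub>R f' (fst z) (fst h) + (snd h * s' (snd z)) *\<^sub>R f (fst z)"
  have "((\<lambda>z. s (snd z) *\<^sub>R f (fst z)) has_derivative ?D z) (at z within S \<times> J)"
    if z: "z \<in> S \<times> J" for z
  proof -
    have "(f has_derivative f' (fst z)) (at (fst z) within fst ` (S \<times> J))"
      using z f'(1) by (auto intro: has_derivative_subset)
    from has_derivative_in_compose[OF has_derivative_fst[OF has_derivative_ident] this]
    have F: "((\<lambda>z. f (fst z)) has_derivative (\<lambda>h. f' (fst z) (fst h))) (at z within S \<times> J)" .
    have "(s has_derivative (\<lambda>h. h * s' (snd z))) (at (snd z) within snd ` (S \<times> J))"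
      using s[of "snd z"] z unfolding has_field_derivative_def
      by (auto intro: has_derivative_at_withinI simp: mult_commute_abs)
    from has_derivative_in_compose[OF has_derivative_snd[OF has_derivative_ident] this]
    have G: "((\<lambda>z. s (snd z)) has_derivative (\<lambda>h. snd h * s' (snd z))) (at z within S \<times> J)" .
    show ?thesis using has_derivative_scaleR[OF G F] by simp
  qed
  moreover have "Ck_on r (S \<times> J) (\<lambda>z. ?D z e)" if "e \<in> Basis" for e
  proof -
    from that consider (x) u where "u \<in> Basis" "e = (u, 0)" | (t) "e = (0, 1)"
      by (auto simp: Basis_prod_def)
    then show ?thesis
    proof cases
      case x
      then show ?thesis using Suc.IH[of "\<lambda>x. f' x u"] f'(2) by (simp add: s_def)
    next
      case t
      moreover have "f' x 0 = 0" if "x \<in> S" for x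
        using f'(1) that has_derivative_linear linear_0 by blast
      ultimately show ?thesis
        by (intro Ck_on_cong[OF Suc.IH[OF Ck_on_Suc_imp_Ck_on[OF Suc.prems], of "C * (q * \<beta>)" "q - 1"]])
          (auto simp: s'_def)
    qed
  qed
  ultimately show ?case
    unfolding Ck_on.simps(2) s_def[symmetric]
    by (intro exI[of _ ?D]) (simp add: s_def)
qed

lemma has_derivative_slice_fst:
  assumes "(\<Psi> has_derivative D) (at (x, t) within V \<times> I)" "open V" "x \<in> V" "t \<in> I"
  shows "((\<lambda>y. \<Psi> (y, t)) has_derivative (\<lambda>v. D (v, 0))) (at x)"
proof -
  have "((\<lambda>y. (y, t)) has_derivative (\<lambda>v. (v, 0))) (at x within V)"
    by (intro has_derivative_Pair has_derivative_ident has_derivative_const)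
  moreover have "(\<Psi> has_derivative D) (at (x, t) within (\<lambda>y. (y, t)) ` V)"
    by (rule has_derivative_subset[OF assms(1)]) (use assms(4) in auto)
  ultimately show ?thesis
    using has_derivative_in_compose[of "\<lambda>y. (y, t)" "\<lambda>v. (v, 0)" x V \<Psi> D] at_within_open[OF assms(3,2)]
    by simp
qed

lemma has_vector_derivative_slice_snd:
  assumes "(\<Psi> has_derivative D) (at (x, t) within V \<times> I)" "x \<in> V"
  shows "((\<lambda>s. \<Psi> (x, s)) has_vector_derivative D (0, 1)) (at t within I)"
proof -
  have "((\<lambda>s. (x, s)) has_derivative (\<lambda>h. (0, h))) (at t within I)"
    by (intro has_derivative_Pair has_derivative_ident has_derivative_const)
  moreover have "(\<Psi> has_derivative D) (at (x, t) within (\<lambda>s. (x, s)) ` I)"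
    by (rule has_derivative_subset[OF assms(1)]) (use assms(2) in auto)
  ultimately have "((\<lambda>s. \<Psi> (x, s)) has_derivative (\<lambda>h. D (0, h))) (at t within I)"
    by (rule has_derivative_in_compose)
  moreover have "(\<lambda>h. D (0, h)) = (\<lambda>h. h *\<^sub>R D (0, 1))"
    by (subst linear_scale[OF has_derivative_linear[OF assms(1)], symmetric]) simp
  ultimately show ?thesis by (simp only: has_vector_derivative_def)
qed

section \<open>The position vector stays normal\<close>

context symmetric_form begin

text \<open>
  Here \<open>D (x, t) (0, 1)\<close> is the velocity, written \<open>H\<close> in this comment, and the vectors \<open>D (x, t) (v, 0)\<close> are
  the tangent vectors of the immersion at time \<open>t\<close>. The hypotheses say that \<open>H\<close> is normal and a
  multiple of the normal part of the position vector, with a factor \<open>- a\<close> that depends on time only.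

  The identity \<open>\<partial>\<^sub>tw\<^sub>i = 2 b \<Psi>\<^sup>\<top> (\<partial>\<^sub>iH)\<close> of the introduction needs a division by \<open>a\<close>; at
  times with \<open>a = 0\<close> the velocity vanishes on the whole chart, and both sides are zero.
\<close>
lemma position_stays_normal:
  fixes V :: "(real^'m::finite) set" and \<Psi> :: "(real^'m) \<times> real \<Rightarrow> real^'n"
  assumes V: "open V"
    and I: "\<And>t. t \<in> I \<Longrightarrow> 0 \<le> t \<and> {0..t} \<subseteq> I" "open (I \<inter> {0<..})"
    and \<Psi>: "\<And>z. z \<in> V \<times> I \<Longrightarrow> (\<Psi> has_derivative D z) (at z within V \<times> I)"
    and C1: "\<And>e. e \<in> Basis \<Longrightarrow> Ck_on (Suc 0) (V \<times> I) (\<lambda>z. D z e)"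
    and nondeg: "\<And>x t v. \<lbrakk>x \<in> V; t \<in> I; \<And>u. b (D (x, t) (v, 0)) (D (x, t) (u, 0)) = 0\<rbrakk> \<Longrightarrow> v = 0"
    and normal: "\<And>x t v. \<lbrakk>x \<in> V; t \<in> I; 0 < t\<rbrakk> \<Longrightarrow> b (D (x, t) (0, 1)) (D (x, t) (v, 0)) = 0"
    and homothetic: "\<And>t. \<lbrakk>t \<in> I; 0 < t\<rbrakk> \<Longrightarrow> \<exists>a. \<forall>x\<in>V. \<exists>v.
        D (x, t) (0, 1) = - a *\<^sub>R (\<Psi> (x, t) - D (x, t) (v, 0)) \<and>
        (\<forall>u. b (\<Psi> (x, t) - D (x, t) (v, 0)) (D (x, t) (u, 0)) = 0)"
    and init: "\<And>x v. x \<in> V \<Longrightarrow> b (\<Psi> (x, 0)) (D (x, 0) (v, 0)) = 0"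
    and x: "x \<in> V" and t: "t \<in> I"
  shows "b (\<Psi> (x, t)) (D (x, t) (v, 0)) = 0"
proof -
  define E :: "'m \<Rightarrow> (real^'m) \<times> real" where "E = (\<lambda>i. (axis i 1, 0))"
  define N :: "(real^'m) \<times> real" where "N = (0, 1)"
  have E: "E i \<in> Basis" for i by (simp add: E_def Basis_prod_def axis_in_Basis_iff)
  have N: "N \<in> Basis" by (simp add: N_def Basis_prod_def)
  have "\<forall>e\<in>Basis. \<exists>D2. (\<forall>z\<in>V \<times> I. ((\<lambda>z. D z e) has_derivative D2 z) (at z within V \<times> I)) \<and>
      (\<forall>e'\<in>Basis. continuous_on (V \<times> I) (\<lambda>z. D2 z e'))"
    using C1 by simp
  from bchoice[OF this] obtain D2 where D2_all:
      "\<forall>e\<in>Basis. (\<forall>z\<in>V \<times> I. ((\<lambda>z. D z e) has_derivative D2 e z) (at z within V \<times> I)) \<and>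
        (\<forall>e'\<in>Basis. continuous_on (V \<times> I) (\<lambda>z. D2 e z e'))" ..
  then have D2: "((\<lambda>z. D z e) has_derivative D2 e z) (at z within V \<times> I)"
      if "e \<in> Basis" "z \<in> V \<times> I" for e z
    using that by blast
  from D2_all have cD2: "continuous_on (V \<times> I) (\<lambda>z. D2 e z e')"
      if "e \<in> Basis" "e' \<in> Basis" for e e'
    using that by blast
  have cD: "continuous_on (V \<times> I) (\<lambda>z. D z e)" if "e \<in> Basis" for e
    using Ck_on_Suc_imp_Ck_on[OF C1[OF that]] by simp
  have c\<Psi>: "continuous_on (V \<times> I) \<Psi>"
    using \<Psi> has_derivative_continuous continuous_on_eq_continuous_within by blast
  have lin: "linear (\<lambda>v. D z (v, 0))" if "z \<in> V \<times> I" for z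
  proof -
    have "linear (\<lambda>v. (v, 0 :: real))" by (rule linearI) auto
    from linear_compose[OF this has_derivative_linear[OF \<Psi>[OF that]]] show ?thesis by (simp add: o_def)
  qed
  have D_sum: "D z (v, 0) = (\<Sum>i\<in>UNIV. v $ i *\<^sub>R D z (E i))" if "z \<in> V \<times> I" for z v
    unfolding E_def by (rule linear_eq_sum_axis[OF lin[OF that]])
  \<comment> \<open>Only positive times are interior, so derivatives in time and space are interchanged there.\<close>
  have mixed: "D2 (E i) (x, s) N = D2 N (x, s) (E i)" if s: "s \<in> I" "0 < s" for i s
  proof (rule symmetric_second_derivative[where S = "V \<times> (I \<inter> {0<..})" and f = \<Psi> and f' = D])
    let ?O = "V \<times> (I \<inter> {0<..})"
    show O: "open ?O" using V I(2) by (rule open_Times)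
    show "(x, s) \<in> ?O" using x s by simp
    fix y assume y: "y \<in> ?O"
    have at: "at y within V \<times> I = at y"
      by (rule at_within_open_subset[OF y O]) auto
    show "(\<Psi> has_derivative D y) (at y)" using \<Psi>[of y] y at by auto
    show "((\<lambda>y. D y (E i)) has_derivative D2 (E i) y) (at y)"
      "((\<lambda>y. D y N) has_derivative D2 N y) (at y)"
      using D2[OF E, of y i] D2[OF N, of y] y unfolding at by auto
  qed (auto intro!: continuous_on_subset[OF cD2] E N)
  \<comment> \<open>The vector \<open>D (x, s) (v, 0)\<close> is the tangential part of the position vector.\<close>
  have pointwise: "\<exists>v. (\<forall>i. b (\<Psi> (x, s)) (D (x, s) (E i)) = b (D (x, s) (v, 0)) (D (x, s) (E i)) \<and>
      b (\<Psi> (x, s)) (D2 N (x, s) (E i)) = 2 * b (D (x, s) (v, 0)) (D2 N (x, s) (E i)))"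
    if s: "s \<in> I" "0 < s" for s
  proof -
    obtain a where a: "\<And>y. y \<in> V \<Longrightarrow> \<exists>v. D (y, s) (0, 1) = - a *\<^sub>R (\<Psi> (y, s) - D (y, s) (v, 0)) \<and>
        (\<forall>u. b (\<Psi> (y, s) - D (y, s) (v, 0)) (D (y, s) (u, 0)) = 0)"
      using homothetic[OF s] by blast
    obtain v where v: "D (x, s) N = - a *\<^sub>R (\<Psi> (x, s) - D (x, s) (v, 0))"
        "\<And>u. b (\<Psi> (x, s) - D (x, s) (v, 0)) (D (x, s) (u, 0)) = 0"
      using a[OF x] unfolding N_def by blast
    define h where "h = (\<lambda>y. D (y, s) N)"
    have dh: "(h has_derivative (\<lambda>u. D2 N (x, s) (u, 0))) (at x)"
      unfolding h_def by (rule has_derivative_slice_fst[OF D2[OF N] V x s(1)]) (use x s in auto)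
    have d\<Psi>: "((\<lambda>y. \<Psi> (y, s)) has_derivative (\<lambda>u. D (x, s) (u, 0))) (at x)"
      by (rule has_derivative_slice_fst[OF \<Psi> V x s(1)]) (use x s in auto)
    have "b (\<Psi> (x, s)) (D2 N (x, s) (u, 0)) = 2 * b (D (x, s) (v, 0)) (D2 N (x, s) (u, 0))" for u
    proof -
      \<comment> \<open>\<open>b h h = - a b \<Psi> h\<close>, because \<open>h\<close> is normal; this is differentiated at \<open>x\<close>.\<close>
      have hh: "b (h y) (h y) + a * b (\<Psi> (y, s)) (h y) = 0" if y: "y \<in> V" for y
      proof -
        obtain v where "h y = - a *\<^sub>R (\<Psi> (y, s) - D (y, s) (v, 0))"
          using a[OF y] unfolding h_def N_def by blast
        moreover have "b (h y) (D (y, s) (v, 0)) = 0"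
          unfolding h_def N_def by (rule normal[OF y s])
        then have "b (D (y, s) (v, 0)) (h y) = 0" by (simp add: sym)
        ultimately have "b (h y) (h y) = - a * b (\<Psi> (y, s)) (h y)"
          using scaleR_left[of "- a" "\<Psi> (y, s) - D (y, s) (v, 0)" "h y"]
          by (simp only: diff_left) simp
        then show ?thesis by simp
      qed
      have q0: "((\<lambda>y. b (h y) (h y) + a * b (\<Psi> (y, s)) (h y)) has_derivative (\<lambda>u. 0)) (at x)"
        by (rule has_derivative_transform_within_open[OF has_derivative_const V x]) (simp add: hh)
      have q1: "((\<lambda>y. b (h y) (h y) + a * b (\<Psi> (y, s)) (h y)) has_derivative
          (\<lambda>u. (b (h x) (D2 N (x, s) (u, 0)) + b (D2 N (x, s) (u, 0)) (h x)) +
             a * (b (\<Psi> (x, s)) (D2 N (x, s) (u, 0)) + b (D (x, s) (u, 0)) (h x)))) (at x)"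
        by (intro has_derivative_add has_derivative_mult_right FDERIV dh d\<Psi>)
      have "(b (h x) (D2 N (x, s) (u, 0)) + b (D2 N (x, s) (u, 0)) (h x)) +
             a * (b (\<Psi> (x, s)) (D2 N (x, s) (u, 0)) + b (D (x, s) (u, 0)) (h x)) = 0"
        by (rule fun_cong[OF has_derivative_unique[OF q1 q0]])
      moreover have "b (D (x, s) (u, 0)) (h x) = 0"
        unfolding h_def N_def sym[of _ "D (x, s) (0, 1)"] by (rule normal[OF x s])
      ultimately have *: "2 * b (h x) (D2 N (x, s) (u, 0)) + a * b (\<Psi> (x, s)) (D2 N (x, s) (u, 0)) = 0"
        by (simp add: sym[of _ "h x"])
      show ?thesis
      proof (cases "a = 0")
        case True
        have "h y = 0" if "y \<in> V" for y using a[OF that] True by (auto simp: h_def N_def)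
        then have "(h has_derivative (\<lambda>u. 0)) (at x)"
          by (intro has_derivative_transform_within_open[OF has_derivative_const V x]) simp
        from fun_cong[OF has_derivative_unique[OF dh this], of u] have "D2 N (x, s) (u, 0) = 0" .
        then show ?thesis by (simp add: zero_right)
      next
        case False
        have "b (h x) (D2 N (x, s) (u, 0)) =
            - a * (b (\<Psi> (x, s)) (D2 N (x, s) (u, 0)) - b (D (x, s) (v, 0)) (D2 N (x, s) (u, 0)))"
          unfolding h_def v(1) by (simp only: scaleR_left diff_left real_scaleR_def)
        with * have "a * (b (\<Psi> (x, s)) (D2 N (x, s) (u, 0)) - 2 * b (D (x, s) (v, 0)) (D2 N (x, s) (u, 0))) = 0"
          by (auto simp: algebra_simps)
        with False show ?thesis by simp
      qed
    qed
    with v(2) show ?thesis by (intro exI[of _ v]) (simp add: E_def diff_left)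
  qed
  \<comment> \<open>\<open>w\<close> is \<open>g\<close>, and its derivative \<open>w'\<close> is \<open>B\<close>, applied to the coordinates of the tangential part.\<close>
  define w :: "real \<Rightarrow> real^'m" where "w = (\<lambda>s. \<chi> i. b (\<Psi> (x, s)) (D (x, s) (E i)))"
  define w' :: "real \<Rightarrow> real^'m" where "w' = (\<lambda>s. \<chi> i. b (\<Psi> (x, s)) (D2 N (x, s) (E i)))"
  define g :: "real \<Rightarrow> real^'m \<Rightarrow> real^'m"
    where "g = (\<lambda>s v. \<chi> i. b (D (x, s) (v, 0)) (D (x, s) (E i)))"
  define B :: "real \<Rightarrow> real^'m \<Rightarrow> real^'m"
    where "B = (\<lambda>s v. \<chi> i. 2 * b (D (x, s) (v, 0)) (D2 N (x, s) (E i)))"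
  have sub: "s \<in> I" if "s \<in> {0..t}" for s using I(1)[OF t] that by blast
  have slice: "continuous_on {0..t} (\<lambda>s. G (x, s))" if "continuous_on (V \<times> I) G" for G :: "_ \<Rightarrow> real^'n"
    by (rule continuous_on_compose2[OF that]) (use sub x in \<open>auto intro!: continuous_intros\<close>)
  have slice2: "continuous_on ({0..t} \<times> UNIV) (\<lambda>z. G (x, fst z))" if "continuous_on (V \<times> I) G"
    for G :: "_ \<Rightarrow> real^'n"
    by (rule continuous_on_compose2[OF that]) (use sub x in \<open>auto intro!: continuous_intros\<close>)
  have cv: "continuous_on ({0..t} \<times> UNIV) (\<lambda>z. D (x, fst z) (snd z, 0))"
  proof -
    have "continuous_on ({0..t} \<times> UNIV) (\<lambda>z. \<Sum>i\<in>UNIV. snd z $ i *\<^sub>R D (x, fst z) (E i))"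
      by (intro continuous_intros slice2 cD E)
    then show ?thesis
      by (rule continuous_on_eq) (use sub x in \<open>auto simp: D_sum\<close>)
  qed
  obtain K where K: "\<And>s v. s \<in> {0..t} \<Longrightarrow> norm (B s v) \<le> K * norm (g s v)"
  proof (rule linear_family_bound[of "{0..t}" g B])
    fix s assume s: "s \<in> {0..t}"
    have z: "(x, s) \<in> V \<times> I" using x sub s by auto
    show "linear (g s)" "linear (B s)"
      unfolding g_def B_def
      by (auto intro!: linearI simp: vec_eq_iff linear_add[OF lin[OF z]] linear_scale[OF lin[OF z]]
          add_left scaleR_left algebra_simps)
    show "v = 0" if "g s v = 0" for v
    proof (rule nondeg[OF x sub[OF s]])
      fix u
      show "b (D (x, s) (v, 0)) (D (x, s) (u, 0)) = 0"
        using that by (simp add: D_sum[OF z, of u] sum_right scaleR_right g_def vec_eq_iff)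
    qed
  next
    show "continuous_on ({0..t} \<times> UNIV) (\<lambda>(s, v). g s v)"
      "continuous_on ({0..t} \<times> UNIV) (\<lambda>(s, v). B s v)"
      unfolding g_def B_def case_prod_unfold
      by (intro continuous_on_vec_lambda continuous_on_mult_left continuous_on cv slice2 cD cD2 E N)+
  qed auto
  have "w t = 0"
  proof (rule gronwall_zero)
    show "0 \<le> t" using I(1)[OF t] by simp
    show "w 0 = 0" using init[OF x] by (simp add: w_def vec_eq_iff E_def)
    show "continuous_on {0..t} w"
      unfolding w_def by (intro continuous_on_vec_lambda continuous_on slice cD E c\<Psi>)
    fix s assume s: "0 < s" "s < t"
    have sI: "s \<in> I" using s by (intro sub) auto
    have z: "(x, s) \<in> V \<times> I" using x sI by auto
    have at: "at s within I = at s"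
      by (rule at_within_open_subset[OF _ I(2)]) (use s sI in auto)
    have "((\<lambda>s. b (\<Psi> (x, s)) (D (x, s) (E i))) has_vector_derivative
        b (\<Psi> (x, s)) (D2 N (x, s) (E i))) (at s)" for i
    proof -
      have "((\<lambda>s. b (\<Psi> (x, s)) (D (x, s) (E i))) has_vector_derivative
        b (\<Psi> (x, s)) (D2 (E i) (x, s) N) + b (D (x, s) N) (D (x, s) (E i))) (at s)"
        unfolding N_def
        using has_vector_derivative[OF has_vector_derivative_slice_snd[OF \<Psi>[OF z] x]
            has_vector_derivative_slice_snd[OF D2[OF E z] x]] at by simp
      then show ?thesis
        using normal[OF x sI s(1)] mixed[OF sI s(1)] by (simp add: N_def E_def)
    qed
    then show "(w has_vector_derivative w' s) (at s)"
      unfolding w_def w'_def has_vector_derivative_def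
      by (subst has_derivative_componentwise_within) (auto simp: Basis_vec_def inner_axis)
    obtain v where v: "\<And>i. b (\<Psi> (x, s)) (D (x, s) (E i)) = b (D (x, s) (v, 0)) (D (x, s) (E i))"
      "\<And>i. b (\<Psi> (x, s)) (D2 N (x, s) (E i)) = 2 * b (D (x, s) (v, 0)) (D2 N (x, s) (E i))"
      using pointwise[OF sI s(1)] by blast
    then have "w s = g s v" "w' s = B s v" by (simp_all add: w_def w'_def g_def B_def)
    with K[of s v] s show "norm (w' s) \<le> K * norm (w s)" by simp
  qed
  then have "b (\<Psi> (x, t)) (D (x, t) (E i)) = 0" for i by (simp add: w_def vec_eq_iff)
  then show ?thesis using x t by (simp add: D_sum sum_right scaleR_right)
qed

end

definition chart_image :: "('a, 'm::finite) chart \<Rightarrow> (real^'m) set" where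
  "chart_image \<kappa> = snd \<kappa> ` fst \<kappa>"

section \<open>Immersed manifolds\<close>

lemma local_rep_scaleR: "local_rep \<kappa> (\<lambda>p. a *\<^sub>R F p) = (\<lambda>x. a *\<^sub>R local_rep \<kappa> F x)"
  by (simp add: local_rep_def case_prod_unfold fun_eq_iff)

lemma trace_second_fundamental_eq:
  "trace_second_fundamental P b A F p =
     patch_curvature P b (local_rep (chart_at A p) F) (snd (chart_at A p) p)"
  by (simp add: trace_second_fundamental_def patch_curvature_def Let_def)

lemma chart_at:
  assumes "p \<in> carrier A"
  shows "chart_at A p \<in> A" "p \<in> fst (chart_at A p)"
proof -
  obtain c where "c \<in> A \<and> p \<in> fst c" using assms by (auto simp: carrier_def)
  then have "chart_at A p \<in> A \<and> p \<in> fst (chart_at A p)"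
    unfolding chart_at_def by (rule someI)
  then show "chart_at A p \<in> A" "p \<in> fst (chart_at A p)" by auto
qed

locale manifold =
  fixes A :: "('a::{t2_space, second_countable_topology}, 'm::finite) chart set"
  assumes atlas: "smooth_atlas A"
begin

lemma chart:
  assumes "\<kappa> \<in> A"
  shows "open (fst \<kappa>)" "open (chart_image \<kappa>)"
    "homeomorphism (fst \<kappa>) (chart_image \<kappa>) (snd \<kappa>) (inv_into (fst \<kappa>) (snd \<kappa>))"
  using atlas assms by (auto simp: smooth_atlas_def is_chart_def chart_image_def case_prod_unfold)

lemma inv_chart:
  assumes "\<kappa> \<in> A" "p \<in> fst \<kappa>"
  shows "inv_into (fst \<kappa>) (snd \<kappa>) (snd \<kappa> p) = p"
  using chart(3)[OF assms(1)] assms(2) by (simp add: homeomorphism_def)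

lemma local_rep_chart:
  assumes "\<kappa> \<in> A" "p \<in> fst \<kappa>"
  shows "local_rep \<kappa> F (snd \<kappa> p) = F p"
  using inv_chart[OF assms] by (simp add: local_rep_def case_prod_unfold)

lemma chart_image_cases:
  assumes "x \<in> chart_image \<kappa>"
  obtains p where "p \<in> fst \<kappa>" "x = snd \<kappa> p"
  using assms by (auto simp: chart_image_def)

lemma chart_image_mem: "p \<in> fst \<kappa> \<Longrightarrow> snd \<kappa> p \<in> chart_image \<kappa>"
  by (simp add: chart_image_def)

lemma local_rep_cong:
  assumes "\<kappa> \<in> A" "x \<in> chart_image \<kappa>" "\<And>p. p \<in> carrier A \<Longrightarrow> F p = G p"
  shows "local_rep \<kappa> F x = local_rep \<kappa> G x"
proof -
  obtain p where p: "p \<in> fst \<kappa>" "x = snd \<kappa> p" using assms(2) by (rule chart_image_cases)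
  then have "p \<in> carrier A" using assms(1) by (auto simp: carrier_def)
  then show ?thesis unfolding p(2) local_rep_chart[OF assms(1) p(1)] by (rule assms(3))
qed

lemma trace_second_fundamental_cong:
  assumes p: "p \<in> carrier A" and eq: "\<And>q. q \<in> carrier A \<Longrightarrow> F q = G q"
  shows "trace_second_fundamental P b A F p = trace_second_fundamental P b A G p"
  unfolding trace_second_fundamental_eq
  by (rule patch_curvature_cong[OF chart(2)[OF chart_at(1)[OF p]] chart_image_mem[OF chart_at(2)[OF p]]
        local_rep_cong[OF chart_at(1)[OF p] _ eq]])

lemma open_overlap:
  assumes "\<kappa> \<in> A" "\<mu> \<in> A"
  shows "open (overlap \<kappa> \<mu>)"
proof -
  let ?inv = "inv_into (fst \<kappa>) (snd \<kappa>)"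
  have "overlap \<kappa> \<mu> = chart_image \<kappa> \<inter> ?inv -` fst \<mu>"
    using inv_chart[OF assms(1)] by (auto simp: overlap_def case_prod_unfold chart_image_def)
  moreover have "continuous_on (chart_image \<kappa>) ?inv"
    using chart(3)[OF assms(1)] by (simp add: homeomorphism_def)
  ultimately show ?thesis
    using continuous_open_preimage chart(2)[OF assms(1)] chart(1)[OF assms(2)] by metis
qed

end

locale immersed_manifold = manifold A + symmetric_form b
  for A :: "('a::{t2_space, second_countable_topology}, 'm::finite) chart set"
    and b :: "real^'n \<Rightarrow> real^'n \<Rightarrow> real" +
  fixes F :: "'a \<Rightarrow> real^'n"
  assumes immersion: "immersion A F" and metric: "nondegenerate_metric b A F"
begin

lemma smooth_local_rep:
  assumes "\<kappa> \<in> A"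
  shows "Ck_on r (chart_image \<kappa>) (local_rep \<kappa> F)"
  using immersion assms by (auto simp: immersion_def smooth_on_def chart_image_def)

lemma patch:
  assumes "\<kappa> \<in> A"
  shows "immersed_patch b (chart_image \<kappa>) (local_rep \<kappa> F)"
proof
  show "open (chart_image \<kappa>)" by (rule chart(2)[OF assms])
  show "Ck_on (Suc (Suc 0)) (chart_image \<kappa>) (local_rep \<kappa> F)" by (rule smooth_local_rep[OF assms])
  show "nondegenerate (pullback b (local_rep \<kappa> F) x)" if "x \<in> chart_image \<kappa>" for x
    using metric assms that by (auto simp: nondegenerate_metric_def chart_image_def)
qed

abbreviation "chart_derivative \<kappa> p \<equiv> frechet_derivative (local_rep \<kappa> F) (at (snd \<kappa> p))"

text \<open>
  Chain rule for the transition map.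
\<close>
lemma range_chart_derivative_subset:
  assumes "\<kappa> \<in> A" "\<mu> \<in> A" "p \<in> fst \<kappa>" "p \<in> fst \<mu>"
  shows "range (chart_derivative \<kappa> p) \<subseteq> range (chart_derivative \<mu> p)"
proof -
  let ?\<tau> = "transition \<kappa> \<mu>" and ?x = "snd \<kappa> p"
  interpret m: immersed_patch b "chart_image \<mu>" "local_rep \<mu> F" by (rule patch[OF assms(2)])
  have O: "open (overlap \<kappa> \<mu>)" by (rule open_overlap[OF assms(1,2)])
  have x: "?x \<in> overlap \<kappa> \<mu>" using assms(3,4) by (auto simp: overlap_def case_prod_unfold)
  have \<tau>x: "?\<tau> ?x = snd \<mu> p"
    using inv_chart[OF assms(1,3)] by (simp add: transition_def case_prod_unfold)
  have "Ck_on (Suc 0) (overlap \<kappa> \<mu>) ?\<tau>"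
    using atlas assms(1,2) unfolding smooth_atlas_def smooth_on_def by blast
  from Ck_on_has_frechet_derivative[OF O this x]
  have \<tau>: "(?\<tau> has_derivative frechet_derivative ?\<tau> (at ?x)) (at ?x)" .
  have "(local_rep \<mu> F has_derivative chart_derivative \<mu> p) (at (?\<tau> ?x))"
    unfolding \<tau>x by (rule m.has_derivative[OF chart_image_mem[OF assms(4)]])
  from has_derivative_compose[OF \<tau> this]
  have "((\<lambda>y. local_rep \<mu> F (?\<tau> y)) has_derivative
      (\<lambda>v. chart_derivative \<mu> p (frechet_derivative ?\<tau> (at ?x) v))) (at ?x)" .
  moreover have "local_rep \<mu> F (?\<tau> y) = local_rep \<kappa> F y" if "y \<in> overlap \<kappa> \<mu>" for y
  proof -
    from that obtain q where q: "q \<in> fst \<kappa>" "q \<in> fst \<mu>" "y = snd \<kappa> q"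
      by (auto simp: overlap_def case_prod_unfold)
    then show ?thesis
      by (simp add: transition_def case_prod_unfold inv_chart[OF assms(1) q(1)]
          local_rep_chart[OF assms(1) q(1)] local_rep_chart[OF assms(2) q(2)])
  qed
  ultimately have "(local_rep \<kappa> F has_derivative
      (\<lambda>v. chart_derivative \<mu> p (frechet_derivative ?\<tau> (at ?x) v))) (at ?x)"
    by (rule has_derivative_transform_within_open[OF _ O x])
  from frechet_derivative_at[OF this] show ?thesis by (metis image_subsetI rangeI)
qed

lemma tangent_image_eq:
  assumes "\<kappa> \<in> A" "p \<in> fst \<kappa>"
  shows "tangent_image A F p = range (chart_derivative \<kappa> p)"
proof -
  have "p \<in> carrier A" using assms by (auto simp: carrier_def)
  note c = chart_at[OF this]
  show ?thesis
    unfolding tangent_image_def Let_def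
    using range_chart_derivative_subset[OF c(1) assms(1) c(2) assms(2)]
      range_chart_derivative_subset[OF assms(1) c(1) assms(2) c(2)] by simp
qed

text \<open>
  The mean curvature vector is computed in the chart chosen at \<open>p\<close>, but the tangent space it is
  orthogonal to is the same in every chart around \<open>p\<close>. In this form the statement holds in a fixed
  chart for all points at once, as is needed to differentiate it.
\<close>
lemma mean_curvature_normal:
  assumes "\<kappa> \<in> A" "p \<in> fst \<kappa>"
  shows "b (mean_curvature b A F p) (chart_derivative \<kappa> p v) = 0"
proof -
  have p: "p \<in> carrier A" using assms by (auto simp: carrier_def)
  interpret m: immersed_patch b "chart_image (chart_at A p)" "local_rep (chart_at A p) F"
    by (rule patch[OF chart_at(1)[OF p]])
  have "chart_derivative \<kappa> p v \<in> range (chart_derivative (chart_at A p) p)"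
    using tangent_image_eq[OF assms] tangent_image_eq[OF chart_at[OF p]] by auto
  then show ?thesis
    using m.curvature_normal[OF chart_image_mem[OF chart_at(2)[OF p]]]
    by (auto simp: mean_curvature_def trace_second_fundamental_eq)
qed

lemma normal_part_in_chart:
  assumes "\<kappa> \<in> A" "p \<in> fst \<kappa>"
  obtains v where "normal_part b A F p y = y - chart_derivative \<kappa> p v"
    "\<And>u. b (y - chart_derivative \<kappa> p v) (chart_derivative \<kappa> p u) = 0"
proof -
  interpret m: immersed_patch b "chart_image \<kappa>" "local_rep \<kappa> F" by (rule patch[OF assms(1)])
  note x = chart_image_mem[OF assms(2)]
  have "nondegenerate (\<lambda>v w. b (chart_derivative \<kappa> p v) (chart_derivative \<kappa> p w))"
    using m.nondeg[OF x] by (simp add: pullback_def[abs_def])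
  from orth_proj_range[OF m.linear_derivative[OF x] this, of y] that show ?thesis
    unfolding normal_part_def tangent_image_eq[OF assms] by metis
qed

definition position_normal :: bool where
  "position_normal \<longleftrightarrow> (\<forall>\<kappa>\<in>A. \<forall>p\<in>fst \<kappa>. \<forall>v. b (F p) (chart_derivative \<kappa> p v) = 0)"

lemma position_normal_of_constant_norm:
  assumes "\<And>p. p \<in> carrier A \<Longrightarrow> b (F p) (F p) = k"
  shows position_normal
  unfolding position_normal_def
proof (intro ballI allI)
  fix \<kappa> p v assume \<kappa>: "\<kappa> \<in> A" and p: "p \<in> fst \<kappa>"
  interpret m: immersed_patch b "chart_image \<kappa>" "local_rep \<kappa> F" by (rule patch[OF \<kappa>])
  note x = chart_image_mem[OF p]
  let ?f = "local_rep \<kappa> F"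
  have "k = b (?f y) (?f y)" if y: "y \<in> chart_image \<kappa>" for y
  proof -
    obtain q where q: "q \<in> fst \<kappa>" "y = snd \<kappa> q" using y by (rule chart_image_cases)
    then show ?thesis using assms[of q] \<kappa> by (auto simp: carrier_def local_rep_chart[OF \<kappa> q(1)])
  qed
  then have 0: "((\<lambda>y. b (?f y) (?f y)) has_derivative (\<lambda>v. 0)) (at (snd \<kappa> p))"
    by (rule has_derivative_transform_within_open[OF has_derivative_const m.V x])
  note d = m.has_derivative[OF x]
  from fun_cong[OF has_derivative_unique[OF 0 FDERIV[OF d d]], of v]
  show "b (F p) (chart_derivative \<kappa> p v) = 0"
    by (simp add: local_rep_chart[OF \<kappa> p] sym[of _ "F p"])
qed

lemma normal_part_of_normal_position:
  assumes position_normal and p: "p \<in> carrier A"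
  shows "normal_part b A F p (F p) = F p"
proof -
  obtain \<kappa> where \<kappa>: "\<kappa> \<in> A" "p \<in> fst \<kappa>" using p by (auto simp: carrier_def)
  interpret m: immersed_patch b "chart_image \<kappa>" "local_rep \<kappa> F" by (rule patch[OF \<kappa>(1)])
  note x = chart_image_mem[OF \<kappa>(2)]
  obtain v where v: "normal_part b A F p (F p) = F p - chart_derivative \<kappa> p v"
    "\<And>u. b (F p - chart_derivative \<kappa> p v) (chart_derivative \<kappa> p u) = 0"
    using normal_part_in_chart[OF \<kappa>] by blast
  have "b (chart_derivative \<kappa> p v) (chart_derivative \<kappa> p u) = 0" for u
    using v(2)[of u] assms(1) \<kappa> by (simp add: diff_left position_normal_def)
  then have "v = 0" using m.nondeg[OF x] by (simp add: nondegenerate_def pullback_def)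
  then show ?thesis using v(1) linear_0[OF m.linear_derivative[OF x]] by simp
qed

lemma local_rep_position_normal:
  assumes position_normal and \<kappa>: "\<kappa> \<in> A" and y: "y \<in> chart_image \<kappa>"
  shows "b (local_rep \<kappa> F y) (partial i (local_rep \<kappa> F) y) = 0"
proof -
  obtain q where q: "q \<in> fst \<kappa>" "y = snd \<kappa> q" using y by (rule chart_image_cases)
  then show ?thesis
    using assms(1) \<kappa> by (simp add: local_rep_chart[OF \<kappa> q(1)] position_normal_def partial_def)
qed

lemma mean_curvature_position:
  assumes position_normal and p: "p \<in> carrier A"
  shows "b (mean_curvature b A F p) (F p) = - real CARD('m)"
proof -
  note c = chart_at[OF p]
  interpret m: immersed_patch b "chart_image (chart_at A p)" "local_rep (chart_at A p) F"
    by (rule patch[OF c(1)])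
  show ?thesis
    using m.curvature_position[OF chart_image_mem[OF c(2)] local_rep_position_normal[OF assms(1) c(1)]]
    by (simp add: mean_curvature_def trace_second_fundamental_eq local_rep_chart[OF c])
qed

lemma hyperquadric_mean_curvature_eq:
  assumes "nondegenerate b" and position_normal and p: "p \<in> carrier A"
    and k: "b (F p) (F p) = k" "k \<noteq> 0"
  shows "hyperquadric_mean_curvature b A F p = mean_curvature b A F p + (real CARD('m) / k) *\<^sub>R F p"
proof -
  note c = chart_at[OF p]
  interpret m: immersed_patch b "chart_image (chart_at A p)" "local_rep (chart_at A p) F"
    by (rule patch[OF c(1)])
  show ?thesis
    using m.hyperquadric_curvature[OF assms(1) chart_image_mem[OF c(2)] _ k(2)
        local_rep_position_normal[OF assms(2) c(1)]] k(1)
    by (simp add: mean_curvature_def hyperquadric_mean_curvature_def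
        trace_second_fundamental_eq local_rep_chart[OF c])
qed

lemma minimal_in_hyperquadric_iff:
  assumes "nondegenerate b" and norm: "\<And>p. p \<in> carrier A \<Longrightarrow> b (F p) (F p) = k" and "k \<noteq> 0"
  shows "minimal_in_hyperquadric b k A F \<longleftrightarrow>
    (\<forall>p\<in>carrier A. mean_curvature b A F p = - (real CARD('m) / k) *\<^sub>R F p)"
  using hyperquadric_mean_curvature_eq[OF assms(1) position_normal_of_constant_norm[OF norm] _ norm assms(3)]
  by (auto simp: minimal_in_hyperquadric_def hyperquadric_def norm eq_neg_iff_add_eq_0)

lemma immersed_manifold_scaleR:
  assumes "a \<noteq> 0"
  shows "immersed_manifold A b (\<lambda>p. a *\<^sub>R F p)"
proof
  have d: "frechet_derivative (local_rep \<kappa> (\<lambda>p. a *\<^sub>R F p)) (at x) v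
      = a *\<^sub>R frechet_derivative (local_rep \<kappa> F) (at x) v"
    if "\<kappa> \<in> A" "x \<in> chart_image \<kappa>" for \<kappa> x v
    unfolding local_rep_scaleR by (rule immersed_patch.derivative_scaleR[OF patch[OF that(1)] that(2)])
  show "immersion A (\<lambda>p. a *\<^sub>R F p)"
    unfolding immersion_def
  proof (intro ballI, clarify, intro conjI ballI)
    fix U \<phi> assume \<kappa>: "(U, \<phi>) \<in> A"
    show "smooth_on (\<phi> ` U) (local_rep (U, \<phi>) (\<lambda>p. a *\<^sub>R F p))"
      using Ck_on_scaleR[OF smooth_local_rep[OF \<kappa>]]
      by (simp add: smooth_on_def local_rep_scaleR chart_image_def)
    fix x assume "x \<in> \<phi> ` U"
    then have x: "x \<in> chart_image (U, \<phi>)" by (simp add: chart_image_def)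
    have "inj (frechet_derivative (local_rep (U, \<phi>) F) (at x))"
      using immersion \<kappa> x by (auto simp: immersion_def chart_image_def)
    then show "inj (frechet_derivative (local_rep (U, \<phi>) (\<lambda>p. a *\<^sub>R F p)) (at x))"
      using assms by (simp add: inj_def d[OF \<kappa> x])
  qed
  show "nondegenerate_metric b A (\<lambda>p. a *\<^sub>R F p)"
    unfolding nondegenerate_metric_def
  proof (intro ballI, clarify)
    fix U \<phi> p assume \<kappa>: "(U, \<phi>) \<in> A" and p: "p \<in> U"
    show "nondegenerate (pullback b (local_rep (U, \<phi>) (\<lambda>p. a *\<^sub>R F p)) (\<phi> p))"
      using immersed_patch.nondeg[OF immersed_patch.immersed_patch_scaleR[OF patch[OF \<kappa>] assms]]  p
      by (auto simp: chart_image_def local_rep_scaleR)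
  qed
qed

lemma mean_curvature_scaleR:
  assumes "a \<noteq> 0" and p: "p \<in> carrier A"
  shows "mean_curvature b A (\<lambda>p. a *\<^sub>R F p) p = (1 / a) *\<^sub>R mean_curvature b A F p"
  using immersed_patch.curvature_scaleR[OF patch[OF chart_at(1)[OF p]] assms(1) chart_image_mem[OF chart_at(2)[OF p]]]
  by (simp add: mean_curvature_def trace_second_fundamental_eq local_rep_scaleR)

end

section \<open>Homothetic solutions\<close>

lemma time_interval_initial_segment:
  assumes "t \<in> time_interval T"
  shows "0 \<le> t" "{0..t} \<subseteq> time_interval T"
proof -
  show "0 \<le> t" using assms by (simp add: time_interval_def)
  have "ereal s < T" if "s \<le> t" for s
    using that assms by (simp add: time_interval_def) (meson ereal_less_eq(3) le_less_trans)
  then show "{0..t} \<subseteq> time_interval T" by (auto simp: time_interval_def)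
qed

lemma open_time_interval_pos: "open (time_interval T \<inter> {0<..})"
proof -
  have "time_interval T \<inter> {0<..} = ereal -` {..<T} \<inter> {0<..}" by (auto simp: time_interval_def)
  then show ?thesis by (simp add: open_Int open_vimage continuous_on_ereal continuous_on_id)
qed

lemma convex_time_interval: "convex (time_interval T)"
proof (rule is_interval_convex_1[THEN iffD1])
  show "is_interval (time_interval T)"
    unfolding is_interval_1
    by (metis atLeastAtMost_iff order_trans subsetD time_interval_initial_segment)
qed

locale homothetic_mcf = manifold A + symmetric_form b
  for A :: "('a::{t2_space, second_countable_topology}, 'm::finite) chart set"
    and b :: "real^'n \<Rightarrow> real^'n \<Rightarrow> real" +
  fixes F :: "'a \<Rightarrow> real^'n" and k :: real and T :: ereal and \<Phi> :: "real \<Rightarrow> 'a \<Rightarrow> real^'n"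
    and \<gamma> \<gamma>' :: "real \<Rightarrow> real"
  assumes norm: "p \<in> carrier A \<Longrightarrow> b (F p) (F p) = k" and k: "k < 0"
    and mcf: "mcf_solution b A F T \<Phi>"
    and \<gamma>0: "\<gamma> 0 = 1" and \<gamma>_pos: "t \<in> time_interval T \<Longrightarrow> 0 < \<gamma> t"
    and \<gamma>': "t \<in> time_interval T \<Longrightarrow> (\<gamma> has_real_derivative \<gamma>' t) (at t within time_interval T)"
    and homothetic: "\<lbrakk>t \<in> time_interval T; p \<in> carrier A\<rbrakk> \<Longrightarrow>
      mean_curvature b A (\<Phi> t) p = (- (\<gamma>' t / \<gamma> t)) *\<^sub>R normal_part b A (\<Phi> t) p (\<Phi> t p)"
begin

abbreviation "I \<equiv> time_interval T"

lemma zero_in_I: "0 \<in> I"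
  using mcf by (simp add: mcf_solution_def time_interval_def zero_ereal_def)

lemma slice: "t \<in> I \<Longrightarrow> immersed_manifold A b (\<Phi> t)"
  using mcf by unfold_locales (auto simp: mcf_solution_def)

lemma initial: "p \<in> carrier A \<Longrightarrow> \<Phi> 0 p = F p"
  using mcf by (simp add: mcf_solution_def)

lemma flow: "\<lbrakk>p \<in> carrier A; t \<in> I\<rbrakk> \<Longrightarrow>
    ((\<lambda>s. \<Phi> s p) has_vector_derivative mean_curvature b A (\<Phi> t) p) (at t within I)"
  using mcf by (simp add: mcf_solution_def)

lemma initial_position_normal: "immersed_manifold.position_normal A b (\<Phi> 0)"
  using immersed_manifold.position_normal_of_constant_norm[OF slice[OF zero_in_I]] initial norm by metis

text \<open>
  At time 0 the position vector is normal, so the equation reads \<open>H = - \<gamma>'(0) F\<close>; the constant follows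
  by taking the product with \<open>F\<close>.
\<close>
lemma initial_mean_curvature:
  assumes p: "p \<in> carrier A"
  shows "mean_curvature b A F p = - (real CARD('m) / k) *\<^sub>R F p"
proof -
  interpret s: immersed_manifold A b "\<Phi> 0" by (rule slice[OF zero_in_I])
  have H: "mean_curvature b A (\<Phi> 0) p = - \<gamma>' 0 *\<^sub>R \<Phi> 0 p"
    using homothetic[OF zero_in_I p] s.normal_part_of_normal_position[OF initial_position_normal p]
    by (simp add: \<gamma>0)
  have "- real CARD('m) = - \<gamma>' 0 * k"
    using s.mean_curvature_position[OF initial_position_normal p] norm[OF p] initial[OF p]
    by (simp add: H scaleR_left minus_left)
  then have "\<gamma>' 0 = real CARD('m) / k" using k by (simp add: field_simps)
  moreover have "mean_curvature b A F p = mean_curvature b A (\<Phi> 0) p"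
    unfolding mean_curvature_def by (rule trace_second_fundamental_cong[OF p]) (simp add: initial)
  ultimately show ?thesis using H initial[OF p] by simp
qed

text \<open>
  This is \<open>position_stays_normal\<close> in each chart: in the chart the flow equation identifies the time
  derivative with the mean curvature vector, and homothety expresses it by the normal part.
\<close>
lemma position_stays_normal_along_flow:
  assumes t: "t \<in> I"
  shows "immersed_manifold.position_normal A b (\<Phi> t)"
proof -
  interpret st: immersed_manifold A b "\<Phi> t" by (rule slice[OF t])
  interpret s0: immersed_manifold A b "\<Phi> 0" by (rule slice[OF zero_in_I])
  have "b (\<Phi> t p) (st.chart_derivative \<kappa> p v) = 0" if \<kappa>: "\<kappa> \<in> A" and p: "p \<in> fst \<kappa>" for \<kappa> p v
  proof -
    define V where "V = chart_image \<kappa>"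
    define \<Psi> where "\<Psi> = (\<lambda>z. local_rep \<kappa> (\<Phi> (snd z)) (fst z))"
    have V: "open V" unfolding V_def by (rule chart(2)[OF \<kappa>])
    have "Ck_on (Suc (Suc 0)) (V \<times> I) \<Psi>"
      using mcf \<kappa> unfolding mcf_solution_def smooth_on_def V_def \<Psi>_def chart_image_def case_prod_unfold
      prod.collapse by blast
    then obtain D where D: "\<forall>z\<in>V \<times> I. (\<Psi> has_derivative D z) (at z within V \<times> I)"
      "\<forall>e\<in>Basis. Ck_on (Suc 0) (V \<times> I) (\<lambda>z. D z e)"
      unfolding Ck_on.simps(2)[of "Suc 0"] by blast
    have \<Psi>: "\<Psi> (snd \<kappa> q, s) = \<Phi> s q" if "q \<in> fst \<kappa>" for q s
      by (simp add: \<Psi>_def local_rep_chart[OF \<kappa> that])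
    have mem: "q \<in> carrier A" if "q \<in> fst \<kappa>" for q using \<kappa> that by (auto simp: carrier_def)
    have spatial: "frechet_derivative (local_rep \<kappa> (\<Phi> s)) (at x) u = D (x, s) (u, 0)"
      if "x \<in> V" "s \<in> I" for x s u
    proof -
      have "((\<lambda>y. \<Psi> (y, s)) has_derivative (\<lambda>u. D (x, s) (u, 0))) (at x)"
        by (rule has_derivative_slice_fst[OF _ V that]) (use D(1) that in blast)
      then have "(local_rep \<kappa> (\<Phi> s) has_derivative (\<lambda>u. D (x, s) (u, 0))) (at x)"
        by (simp add: \<Psi>_def)
      from fun_cong[OF frechet_derivative_at[OF this], of u] show ?thesis by simp
    qed
    have temporal: "D (snd \<kappa> q, s) (0, 1) = mean_curvature b A (\<Phi> s) q"
      if q: "q \<in> fst \<kappa>" and s: "s \<in> I" "0 < s" for q s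
    proof -
      have x: "snd \<kappa> q \<in> V" unfolding V_def by (rule chart_image_mem[OF q])
      have at: "at s within I = at s"
        by (rule at_within_open_subset[OF _ open_time_interval_pos]) (use s in auto)
      have "((\<lambda>s. \<Psi> (snd \<kappa> q, s)) has_vector_derivative D (snd \<kappa> q, s) (0, 1)) (at s)"
        using has_vector_derivative_slice_snd[OF _ x] D(1) x s(1) at by force
      then have "((\<lambda>s. \<Phi> s q) has_vector_derivative D (snd \<kappa> q, s) (0, 1)) (at s)"
        by (simp add: \<Psi>[OF q])
      with flow[OF mem[OF q] s(1)] show ?thesis
        unfolding at using vector_derivative_unique_at by blast
    qed
    have "b (\<Psi> (snd \<kappa> p, t)) (D (snd \<kappa> p, t) (v, 0)) = 0"
    proof (rule position_stays_normal[where V = V and I = I and D = D and \<Psi> = \<Psi>])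
      show "0 \<le> s \<and> {0..s} \<subseteq> I" if "s \<in> I" for s
        using time_interval_initial_segment[OF that] by blast
      show "v = 0" if x: "x \<in> V" and s: "s \<in> I" and v: "\<And>u. b (D (x, s) (v, 0)) (D (x, s) (u, 0)) = 0"
        for x s v
        using immersed_patch.nondeg[OF immersed_manifold.patch[OF slice[OF s] \<kappa>] x[unfolded V_def]] v
        by (simp add: nondegenerate_def pullback_def spatial[OF x s])
      show "b (D (x, s) (0, 1)) (D (x, s) (v, 0)) = 0" if x: "x \<in> V" and s: "s \<in> I" "0 < s" for x s v
      proof -
        obtain q where q: "q \<in> fst \<kappa>" "x = snd \<kappa> q" using x unfolding V_def by (rule chart_image_cases)
        show ?thesis
          using immersed_manifold.mean_curvature_normal[OF slice[OF s(1)] \<kappa> q(1), of v]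
          unfolding q(2) temporal[OF q(1) s] spatial[OF x[unfolded q(2)] s(1)] .
      qed
      show "\<exists>a. \<forall>x\<in>V. \<exists>v. D (x, s) (0, 1) = - a *\<^sub>R (\<Psi> (x, s) - D (x, s) (v, 0)) \<and>
          (\<forall>u. b (\<Psi> (x, s) - D (x, s) (v, 0)) (D (x, s) (u, 0)) = 0)" if s: "s \<in> I" "0 < s" for s
      proof (intro exI[of _ "\<gamma>' s / \<gamma> s"] ballI)
        fix x assume x: "x \<in> V"
        obtain q where q: "q \<in> fst \<kappa>" "x = snd \<kappa> q" using x unfolding V_def by (rule chart_image_cases)
        note sp = spatial[OF x[unfolded q(2)] s(1)]
        obtain v where v: "normal_part b A (\<Phi> s) q (\<Phi> s q) = \<Phi> s q - D (x, s) (v, 0)"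
          "\<And>u. b (\<Phi> s q - D (x, s) (v, 0)) (D (x, s) (u, 0)) = 0"
          using immersed_manifold.normal_part_in_chart[OF slice[OF s(1)] \<kappa> q(1), of "\<Phi> s q"]
          unfolding q(2) sp by blast
        show "\<exists>v. D (x, s) (0, 1) = - (\<gamma>' s / \<gamma> s) *\<^sub>R (\<Psi> (x, s) - D (x, s) (v, 0)) \<and>
          (\<forall>u. b (\<Psi> (x, s) - D (x, s) (v, 0)) (D (x, s) (u, 0)) = 0)"
          using v homothetic[OF s(1) mem[OF q(1)]] unfolding q(2) temporal[OF q(1) s] \<Psi>[OF q(1)]
          by (intro exI[of _ v]) simp
      qed
      show "b (\<Psi> (x, 0)) (D (x, 0) (v, 0)) = 0" if x: "x \<in> V" for x v
      proof -
        obtain q where q: "q \<in> fst \<kappa>" "x = snd \<kappa> q" using x unfolding V_def by (rule chart_image_cases)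
        have "b (\<Phi> 0 q) (s0.chart_derivative \<kappa> q v) = 0"
          using initial_position_normal \<kappa> q(1) by (simp add: s0.position_normal_def)
        then show ?thesis
          unfolding q(2) \<Psi>[OF q(1)] spatial[OF x[unfolded q(2)] zero_in_I] .
      qed
      show "snd \<kappa> p \<in> V" unfolding V_def by (rule chart_image_mem[OF p])
    qed (use V D t open_time_interval_pos in blast)+
    then show ?thesis
      unfolding \<Psi>[OF p] spatial[OF chart_image_mem[OF p, folded V_def] t] .
  qed
  then show ?thesis by (simp add: st.position_normal_def)
qed

lemma mean_curvature_eq:
  assumes "t \<in> I" "p \<in> carrier A"
  shows "mean_curvature b A (\<Phi> t) p = (- (\<gamma>' t / \<gamma> t)) *\<^sub>R \<Phi> t p"
  using homothetic[OF assms]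
    immersed_manifold.normal_part_of_normal_position[OF slice[OF assms(1)] position_stays_normal_along_flow[OF assms(1)] assms(2)]
  by simp

text \<open>
  The position vector is its own normal part, hence \<open>\<gamma>' \<Phi> + \<gamma> H = 0\<close>.
\<close>
lemma scaled_flow_constant:
  assumes t: "t \<in> I" and p: "p \<in> carrier A"
  shows "\<gamma> t *\<^sub>R \<Phi> t p = F p"
proof -
  have "((\<lambda>s. \<gamma> s *\<^sub>R \<Phi> s p) has_derivative (\<lambda>h. 0)) (at s within I)" if s: "s \<in> I" for s
  proof -
    have "((\<lambda>s. \<gamma> s *\<^sub>R \<Phi> s p) has_vector_derivative
        \<gamma> s *\<^sub>R mean_curvature b A (\<Phi> s) p + \<gamma>' s *\<^sub>R \<Phi> s p) (at s within I)"
      by (rule has_vector_derivative_scaleR[OF \<gamma>'[OF s] flow[OF p s]])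
    also have "\<gamma> s *\<^sub>R mean_curvature b A (\<Phi> s) p + \<gamma>' s *\<^sub>R \<Phi> s p = 0"
      using \<gamma>_pos[OF s] by (simp add: mean_curvature_eq[OF s p])
    finally show ?thesis by (simp add: has_vector_derivative_def)
  qed
  from has_derivative_zero_constant[OF convex_time_interval this]
  obtain C where "\<And>s. s \<in> I \<Longrightarrow> \<gamma> s *\<^sub>R \<Phi> s p = C" by blast
  from this[OF t] this[OF zero_in_I] show ?thesis by (simp add: \<gamma>0 initial[OF p])
qed

text \<open>
  By \<open>b H \<Phi> = - m\<close> the squared norm decreases at the rate \<open>2 m\<close>.
\<close>
lemma norm_flow:
  assumes t: "t \<in> I" and p: "p \<in> carrier A"
  shows "b (\<Phi> t p) (\<Phi> t p) = k - 2 * real CARD('m) * t"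
proof -
  have "((\<lambda>s. b (\<Phi> s p) (\<Phi> s p) + 2 * real CARD('m) * s) has_derivative (\<lambda>h. 0)) (at s within I)"
    if s: "s \<in> I" for s
  proof -
    have "b (mean_curvature b A (\<Phi> s) p) (\<Phi> s p) = - real CARD('m)"
      by (rule immersed_manifold.mean_curvature_position[OF slice[OF s] position_stays_normal_along_flow[OF s] p])
    moreover have "((\<lambda>s. b (\<Phi> s p) (\<Phi> s p)) has_vector_derivative
        b (\<Phi> s p) (mean_curvature b A (\<Phi> s) p) + b (mean_curvature b A (\<Phi> s) p) (\<Phi> s p)) (at s within I)"
      by (rule has_vector_derivative[OF flow[OF p s] flow[OF p s]])
    ultimately have "((\<lambda>s. b (\<Phi> s p) (\<Phi> s p)) has_derivative (\<lambda>h. h * (- (2 * real CARD('m))))) (at s within I)"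
      by (simp add: has_vector_derivative_def sym[of "\<Phi> s p" "mean_curvature b A (\<Phi> s) p"])
    moreover have "((\<lambda>s. 2 * real CARD('m) * s) has_derivative (\<lambda>h. 2 * real CARD('m) * h)) (at s within I)"
      by (intro has_derivative_mult_right has_derivative_ident)
    ultimately show ?thesis
      by (rule has_derivative_add[THEN has_derivative_eq_rhs]) (auto simp: fun_eq_iff algebra_simps)
  qed
  from has_derivative_zero_constant[OF convex_time_interval this]
  obtain C where "\<And>s. s \<in> I \<Longrightarrow> b (\<Phi> s p) (\<Phi> s p) + 2 * real CARD('m) * s = C" by blast
  from this[OF t] this[OF zero_in_I] show ?thesis by (simp add: norm[OF p] initial[OF p])
qed

text \<open>
  Both descriptions of the squared norm, \<open>k / \<gamma>\<^sup>2\<close> and \<open>k - 2 m t\<close>, agree; this determines \<open>\<gamma>\<close>.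
\<close>
lemma flow_eq:
  assumes t: "t \<in> I" and p: "p \<in> carrier A"
  shows "\<Phi> t p = (sqrt (- k + 2 * real CARD('m) * t) / sqrt (- k)) *\<^sub>R F p"
proof -
  have pos: "- k + 2 * real CARD('m) * t > 0"
    using k time_interval_initial_segment(1)[OF t] by (intro add_pos_nonneg) auto
  have "k = (\<gamma> t)\<^sup>2 * (k - 2 * real CARD('m) * t)"
    using norm[OF p] norm_flow[OF t p]
    by (simp add: scaled_flow_constant[OF t p, symmetric] scaleR_left scaleR_right power2_eq_square)
  then have "(1 / \<gamma> t)\<^sup>2 = (- k + 2 * real CARD('m) * t) / (- k)"
    using \<gamma>_pos[OF t] k by (simp add: field_simps)
  then have "1 / \<gamma> t = sqrt ((- k + 2 * real CARD('m) * t) / (- k))"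
    using \<gamma>_pos[OF t] by (metis less_imp_le real_sqrt_unique zero_le_divide_1_iff)
  also have "\<dots> = sqrt (- k + 2 * real CARD('m) * t) / sqrt (- k)" by (rule real_sqrt_divide)
  finally show ?thesis
    using \<gamma>_pos[OF t] scaled_flow_constant[OF t p] by (metis divide_inverse_commute inverse_eq_divide
      scaleR_scaleR mult.right_neutral scaleR_one left_inverse less_irrefl)
qed

end

section \<open>The homothety of a minimal immersion\<close>

text \<open>
  With \<open>\<beta> = 2 m\<close> the last derivative is \<open>(1 / c)' = - (m / k) c\<close>, the equation that makes
  \<open>1 / c(t) F\<close> a solution of the flow.
\<close>
lemma
  fixes k \<beta> t :: real
  assumes c_def: "c = (\<lambda>t. sqrt (- k) * (- k + \<beta> * t) powr (- 1 / 2))"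
    and k: "k < 0" and \<beta>: "0 \<le> \<beta>" and t: "0 \<le> t"
  shows factor_pos: "0 < c t"
    and inverse_factor: "inverse (c t) = sqrt (- k + \<beta> * t) / sqrt (- k)"
    and inverse_factor_powr: "inverse (c t) = (1 / sqrt (- k)) * (- k + \<beta> * t) powr (1 / 2)"
    and factor_derivative: "(c has_real_derivative \<beta> / (2 * k) * c t ^ 3) (at t within S)"
    and inverse_factor_derivative: "((\<lambda>t. inverse (c t)) has_real_derivative - \<beta> / (2 * k) * c t) (at t within S)"
proof -
  have pos: "0 < - k + \<beta> * t" using k \<beta> t by (intro add_pos_nonneg) auto
  have sk: "sqrt (- k) > 0" "sqrt (- k) * sqrt (- k) = - k" using k by simp_all
  show c: "0 < c t" using pos sk by (simp add: c_def)
  show p: "inverse (c t) = (1 / sqrt (- k)) * (- k + \<beta> * t) powr (1 / 2)"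
    using powr_minus[of "- k + \<beta> * t" "1 / 2"] by (simp add: c_def field_simps)
  then show "inverse (c t) = sqrt (- k + \<beta> * t) / sqrt (- k)"
    using pos powr_half_sqrt[of "- k + \<beta> * t"] by simp
  have d: "(c has_real_derivative sqrt (- k) * ((- 1 / 2) * (- k + \<beta> * t) powr (- 1 / 2 - 1) * \<beta>)) (at t within S)"
    unfolding c_def using pos by (auto intro!: derivative_eq_intros)
  have "(- k + \<beta> * t) powr (- 1 / 2 - 1) = ((- k + \<beta> * t) powr (- 1 / 2)) ^ 3"
    using pos by (simp add: powr_power)
  moreover have "s * ((- 1 / 2) * y ^ 3 * \<beta>) = \<beta> / (2 * k) * (s * y) ^ 3" if s: "s * s = - k" for s y :: real
  proof -
    have "(s * y) ^ 3 = (s * s) * s * y ^ 3" by (simp add: power_mult_distrib power3_eq_cube)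
    then show ?thesis using k by (simp add: s)
  qed
  ultimately have "sqrt (- k) * ((- 1 / 2) * (- k + \<beta> * t) powr (- 1 / 2 - 1) * \<beta>) = \<beta> / (2 * k) * c t ^ 3"
    unfolding c_def by (metis sk(2))
  with d show d': "(c has_real_derivative \<beta> / (2 * k) * c t ^ 3) (at t within S)" by simp
  show "((\<lambda>t. inverse (c t)) has_real_derivative - \<beta> / (2 * k) * c t) (at t within S)"
    by (rule DERIV_inverse_fun[OF d', THEN DERIV_cong])
      (use c in \<open>auto simp: field_simps power2_eq_square power3_eq_cube\<close>)
qed

theorem theorem3p8:
  fixes A :: "('a::{t2_space, second_countable_topology}, 'm::finite) chart set"
    and b :: "real^'n \<Rightarrow> real^'n \<Rightarrow> real"
    and F :: "'a \<Rightarrow> real^'n"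
    and k :: real
    and c :: "real \<Rightarrow> real"
  defines "c \<equiv> \<lambda>t. sqrt (- k) * (- k + 2 * real CARD('m) * t) powr (- 1 / 2)"
  assumes "bilinear b" and "\<And>x y. b x y = b y x" and "nondegenerate b"
    and "smooth_atlas A" and "connected (carrier A)" and "orientable A"
    and "immersion A F" and "nondegenerate_metric b A F" and "complete_metric b A F"
    and "\<And>p. p \<in> carrier A \<Longrightarrow> b (F p) (F p) = k" and "k < 0"
  shows "((\<exists>T \<Phi>. mcf_solution b A F T \<Phi> \<and> homothety b A T \<Phi>)
            \<longleftrightarrow> minimal_in_hyperquadric b k A F) \<and>
         (minimal_in_hyperquadric b k A F \<longrightarrow>
            mcf_solution b A F \<infinity> (\<lambda>t p. inverse (c t) *\<^sub>R F p) \<and>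
            homothetic_with b A \<infinity> (\<lambda>t p. inverse (c t) *\<^sub>R F p) c \<and>
            (\<forall>T \<Phi>. mcf_solution b A F T \<Phi> \<and> homothety b A T \<Phi> \<longrightarrow>
               (\<forall>p\<in>carrier A. \<forall>t\<in>time_interval T. \<Phi> t p = inverse (c t) *\<^sub>R F p)))"
proof -
  interpret M: immersed_manifold A b F
    using assms by unfold_locales auto
  let ?m = "real CARD('m)"
  note norm = assms(11) and k = assms(12)
  have minimal_iff: "minimal_in_hyperquadric b k A F \<longleftrightarrow>
      (\<forall>p\<in>carrier A. mean_curvature b A F p = - (?m / k) *\<^sub>R F p)"
    by (rule M.minimal_in_hyperquadric_iff) (use assms(4) norm k in auto)
  have mcf: "homothetic_mcf A b F k T \<Phi> \<gamma> \<gamma>'"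
    if "mcf_solution b A F T \<Phi>" "\<gamma> 0 = 1" "\<forall>t\<in>time_interval T. \<gamma> t > 0"
      "\<forall>t\<in>time_interval T. (\<gamma> has_real_derivative \<gamma>' t) (at t within time_interval T) \<and>
        (\<forall>p\<in>carrier A. mean_curvature b A (\<Phi> t) p
             = (- (\<gamma>' t / \<gamma> t)) *\<^sub>R normal_part b A (\<Phi> t) p (\<Phi> t p))" for T \<Phi> \<gamma> \<gamma>'
    using that norm k by unfold_locales auto
  have homothetic: "\<exists>\<gamma> \<gamma>'. homothetic_mcf A b F k T \<Phi> \<gamma> \<gamma>'"
    if "mcf_solution b A F T \<Phi>" "homothety b A T \<Phi>" for T \<Phi>
    using that(2) mcf[OF that(1)] unfolding homothety_def homothetic_with_def by blast
  have minimal: "minimal_in_hyperquadric b k A F"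
    if "mcf_solution b A F T \<Phi>" "homothety b A T \<Phi>" for T \<Phi>
    using homothetic[OF that] homothetic_mcf.initial_mean_curvature unfolding minimal_iff by blast
  have time_pos: "t \<in> time_interval T \<Longrightarrow> 0 \<le> t" for t T by (simp add: time_interval_def)
  have m: "0 \<le> 2 * ?m" by simp
  have c: "c = (\<lambda>t. sqrt (- k) * (- k + 2 * ?m * t) powr (- 1 / 2))" by (simp add: c_def)
  note scale = factor_pos[OF c k m] inverse_factor[OF c k m] inverse_factor_powr[OF c k m]
    factor_derivative[OF c k m] inverse_factor_derivative[OF c k m]
  have unique: "\<Phi> t p = inverse (c t) *\<^sub>R F p"
    if "mcf_solution b A F T \<Phi>" "homothety b A T \<Phi>" "p \<in> carrier A" "t \<in> time_interval T" for T \<Phi> p t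
    using homothetic[OF that(1,2)] homothetic_mcf.flow_eq[OF _ that(4,3)]
    unfolding scale(2)[OF time_pos[OF that(4)]] by blast
  have c0: "c 0 = 1"
  proof -
    have "inverse (c 0) = 1" using scale(2)[of 0] k by simp
    then show ?thesis by (metis inverse_1 inverse_inverse_eq)
  qed
  have flow: "mcf_solution b A F \<infinity> (\<lambda>t p. inverse (c t) *\<^sub>R F p)"
    "homothetic_with b A \<infinity> (\<lambda>t p. inverse (c t) *\<^sub>R F p) c" if min: "minimal_in_hyperquadric b k A F"
  proof -
    let ?I = "time_interval \<infinity>"
    let ?\<Phi> = "\<lambda>t p. inverse (c t) *\<^sub>R F p"
    have ne: "inverse (c t) \<noteq> 0" if "t \<in> ?I" for t using scale(1)[OF time_pos[OF that]] by simp
    have slice: "immersed_manifold A b (?\<Phi> t)" if "t \<in> ?I" for t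
      by (rule M.immersed_manifold_scaleR[OF ne[OF that]])
    have H: "mean_curvature b A (?\<Phi> t) p = (- ?m / k * c t) *\<^sub>R F p" if "t \<in> ?I" "p \<in> carrier A" for t p
      using M.mean_curvature_scaleR[OF ne[OF that(1)] that(2)] min that(2)
      by (simp add: minimal_iff inverse_eq_divide)
    show "mcf_solution b A F \<infinity> ?\<Phi>"
      unfolding mcf_solution_def
    proof (intro conjI ballI)
      show "(0::ereal) < \<infinity>" by simp
      show "case \<kappa> of (U, \<phi>) \<Rightarrow> smooth_on (\<phi> ` U \<times> ?I) (\<lambda>(x, t). local_rep (U, \<phi>) (?\<Phi> t) x)"
        if \<kappa>: "\<kappa> \<in> A" for \<kappa>
      proof -
        have "Ck_on r (chart_image \<kappa> \<times> ?I) (\<lambda>(x, t). local_rep \<kappa> (?\<Phi> t) x)" for r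
        proof (rule Ck_on_cong)
          show "Ck_on r (chart_image \<kappa> \<times> ?I)
             (\<lambda>z. ((1 / sqrt (- k)) * (- k + 2 * ?m * snd z) powr (1 / 2)) *\<^sub>R local_rep \<kappa> F (fst z))"
            using k by (intro Ck_on_powr_scaleR M.smooth_local_rep[OF \<kappa>] add_pos_nonneg)
              (auto dest: time_pos)
        qed (auto simp: local_rep_scaleR scale(3) time_pos)
        then show ?thesis by (simp add: smooth_on_def chart_image_def case_prod_unfold)
      qed
      show "immersion A (?\<Phi> t)" "nondegenerate_metric b A (?\<Phi> t)" if "t \<in> ?I" for t
        using slice[OF that] by (simp_all add: immersed_manifold_def immersed_manifold_axioms_def)
      show "((\<lambda>t. ?\<Phi> t p) has_vector_derivative mean_curvature b A (?\<Phi> t) p) (at t within ?I)"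
        if "p \<in> carrier A" "t \<in> ?I" for p t
      proof -
        have "((\<lambda>t. inverse (c t)) has_real_derivative - (2 * ?m) / (2 * k) * c t) (at t within ?I)"
          by (rule scale(5)[OF time_pos[OF that(2)]])
        from has_vector_derivative_scaleR[OF this has_vector_derivative_const[of "F p"]] show ?thesis
          by (simp add: H[OF that(2,1)])
      qed
      show "?\<Phi> 0 p = F p" for p by (simp add: c0)
    qed
    show "homothetic_with b A \<infinity> ?\<Phi> c"
      unfolding homothetic_with_def
    \<comment> \<open>The witness is \<open>c' = - c\<^sup>2 (1 / c)'\<close>.\<close>
    proof (intro conjI ballI exI[of _ "\<lambda>t. ?m / k * c t ^ 3"] c0)
      fix t assume t: "t \<in> ?I"
      note t0 = time_pos[OF t]
      show "0 < c t" by (rule scale(1)[OF t0])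
      show "(c has_real_derivative ?m / k * c t ^ 3) (at t within ?I)"
        using scale(4)[OF t0, of ?I] by simp
      fix p assume p: "p \<in> carrier A"
      interpret s: immersed_manifold A b "?\<Phi> t" by (rule slice[OF t])
      have "s.position_normal"
        by (rule s.position_normal_of_constant_norm[of "inverse (c t) * inverse (c t) * k"])
          (simp add: M.scaleR_left M.scaleR_right norm)
      from s.normal_part_of_normal_position[OF this p]
      show "mean_curvature b A (?\<Phi> t) p = (- (?m / k * c t ^ 3 / c t)) *\<^sub>R normal_part b A (?\<Phi> t) p (?\<Phi> t p)"
        using scale(1)[OF t0] by (simp add: H[OF t p] power3_eq_cube)
    qed
  qed
  show ?thesis
    using minimal unique flow unfolding homothety_def by blast
qed

end
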